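(* Let $n\in\{1,2,3\}$ and let $u:\mathbb{R}^n\to\mathbb{R}$ be a non-constant classical solution of $-\Delta u=u-u^3$ in $\mathbb{R}^n$. Suppose that the zero level set $\{x\in\mathbb{R}^n:u(x)=0\}$ is contained in the half-space $\{x\in\mathbb{R}^n:x_n>0\}$. Then $u$ is one-dimensional; more precisely, there exists $a\in\mathbb{R}$ such that either $u(x)=H(-x_n+a)$ for all $x\in\mathbb{R}^n$, or $u(x)=H(x_n+a)$ for all $x\in\mathbb{R}^n$, where $H(t)=\tanh(t/\sqrt{2})$.
   Context: Points of $\mathbb{R}^n$ are written $x=(x_1,\dots,x_n)$. Solutions are real-valued and understood in the classical ($C^2$) sense on all of $\mathbb{R}^n$; no boundedness, monotonicity, stability or minimality is assumed. *)

theory Defs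
  imports "HOL-Analysis.Analysis"
begin

text \<open>
  The space of points \<open>(x\<^sub>1, \<dots>, x\<^sub>n)\<close> is \<^typ>\<open>real ^ 'n\<close> over a linearly ordered finite index
  type with \<open>n = CARD('n)\<close> elements; the last coordinate \<open>x\<^sub>n\<close> is the one at the greatest index.
\<close>

definition last_coord :: "real ^ 'n::{finite,linorder} \<Rightarrow> real" where
  "last_coord x = x $ Max UNIV"

definition has_partial_at :: "'n::finite \<Rightarrow> (real ^ 'n \<Rightarrow> real) \<Rightarrow> real ^ 'n \<Rightarrow> bool" where
  "has_partial_at i u x \<longleftrightarrow> (\<lambda>t. u (x + t *\<^sub>R axis i 1)) differentiable at 0"

text \<open>Only meaningful at points where \<^const>\<open>has_partial_at\<close> holds.\<close>

definition partial :: "'n::finite \<Rightarrow> (real ^ 'n \<Rightarrow> real) \<Rightarrow> real ^ 'n \<Rightarrow> real" where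
  "partial i u x = deriv (\<lambda>t. u (x + t *\<^sub>R axis i 1)) 0"

definition C1 :: "(real ^ 'n::finite \<Rightarrow> real) \<Rightarrow> bool" where
  "C1 u \<longleftrightarrow> continuous_on UNIV u \<and>
     (\<forall>i. (\<forall>x. has_partial_at i u x) \<and> continuous_on UNIV (partial i u))"

definition C2 :: "(real ^ 'n::finite \<Rightarrow> real) \<Rightarrow> bool" where
  "C2 u \<longleftrightarrow> C1 u \<and> (\<forall>i. C1 (partial i u))"

definition laplacian :: "(real ^ 'n::finite \<Rightarrow> real) \<Rightarrow> real ^ 'n \<Rightarrow> real" where
  "laplacian u x = (\<Sum>i\<in>UNIV. partial i (partial i u) x)"

definition classical_solution :: "(real ^ 'n::finite \<Rightarrow> real) \<Rightarrow> bool" where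
  "classical_solution u \<longleftrightarrow> C2 u \<and> (\<forall>x. - laplacian u x = u x - u x ^ 3)"

definition H :: "real \<Rightarrow> real" where
  "H t = tanh (t / sqrt 2)"

end

theory Submission
  imports Defs
begin

text \<open>
  Up to sign, \<open>u > 0\<close> on \<open>{x\<^sub>n \<le> 0}\<close>. Comparison with subsolutions on large balls gives \<open>u \<ge> 9/10\<close> for
  \<open>x\<^sub>n\<close> very negative, and since \<open>s \<mapsto> s - s\<^sup>3\<close> decreases near \<open>\<plusminus>1\<close>, a maximum principle puts some
  \<open>H (a - x\<^sub>n)\<close> below \<open>u\<close>. Let \<open>a\<close> be the largest such number. If \<open>u\<close> touches \<open>H (a - x\<^sub>n)\<close>, the two agree
  by the strong maximum principle. Otherwise one slides the bent profiles
  \<open>H (a + \<delta> - x\<^sub>n - ln \<theta> / \<surd>2)\<close> under \<open>u\<close>, where \<open>\<theta> = 1 + \<epsilon> L\<close> and \<open>L\<close> is a function of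
  \<open>(x\<^sub>1, \<dots>, x\<^sub>n\<^sub>-\<^sub>1)\<close> that is superharmonic outside a ball and tends to infinity; such an \<open>L\<close> exists since
  \<open>n - 1 \<le> 2\<close>. Letting \<open>\<epsilon> \<rightarrow> 0\<close> contradicts the choice of \<open>a\<close>.
\<close>

subsection \<open>Pure second derivatives along the axes\<close>

text \<open>The gap between \<open>u\<close> and the largest profile below it may close at infinity,
  so its positivity alone gives no room for raising the profile. Where \<open>u\<close> is near 1 or
  the profile is near -1, the monotone cubic forces comparison by itself; for large
  \<open>x_n\<close> the bound \<open>u >= -1\<close> is enough. What remains is the transition
  layer of the profile, unbounded in the transverse directions. Its part near the axis is compact
  and has a positive gap, which fixes the lift once and for all. Away from the axis the barrier must
  be a strict subsolution for all small \<open>\<epsilon>\<close> at once, while its bending undoes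
  the lift at infinity. In three or more variables no function tending to infinity is superharmonic
  outside a ball; this is why the dimension is bounded and why a logarithm appears.\<close>

definition second_partials ::
    "(real ^ 'n::finite \<Rightarrow> real) \<Rightarrow> ('n \<Rightarrow> real ^ 'n \<Rightarrow> real) \<Rightarrow> ('n \<Rightarrow> real ^ 'n \<Rightarrow> real) \<Rightarrow> bool" where
  "second_partials u g h \<longleftrightarrow>
     (\<forall>i x. ((\<lambda>t. u (x + t *\<^sub>R axis i 1)) has_real_derivative g i x) (at 0) \<and>
            ((\<lambda>t. g i (x + t *\<^sub>R axis i 1)) has_real_derivative h i x) (at 0))"

lemma second_partialsI:
  assumes "\<And>i x. ((\<lambda>t. u (x + t *\<^sub>R axis i 1)) has_real_derivative g i x) (at 0)"
    and "\<And>i x. ((\<lambda>t. g i (x + t *\<^sub>R axis i 1)) has_real_derivative h i x) (at 0)"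
  shows "second_partials u g h"
  using assms by (simp add: second_partials_def)

lemma second_partialsD:
  assumes "second_partials u g h"
  shows "((\<lambda>t. u (x + t *\<^sub>R axis i 1)) has_real_derivative g i x) (at 0)"
    and "((\<lambda>t. g i (x + t *\<^sub>R axis i 1)) has_real_derivative h i x) (at 0)"
  using assms by (simp_all add: second_partials_def)

text \<open>Passage from the classical notion to explicit witnesses \<open>g\<close>,
  \<open>h\<close>. The maximum principles below test only unmixed second derivatives, so barriers
  can be handled by formulas instead of \<open>deriv\<close>.\<close>

lemma second_partials_C2:
  assumes "C2 u"
  shows "second_partials u (\<lambda>i. partial i u) (\<lambda>i. partial i (partial i u))"
  using assms
  by (auto simp: second_partials_def C2_def C1_def has_partial_at_def partial_def
      DERIV_deriv_iff_real_differentiable)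

lemma second_partials_cmult:
  assumes "second_partials u g h"
  shows "second_partials (\<lambda>x. c * u x) (\<lambda>i x. c * g i x) (\<lambda>i x. c * h i x)"
  by (intro second_partialsI DERIV_cmult second_partialsD[OF assms])

lemma second_partials_minus:
  assumes "second_partials u g h"
  shows "second_partials (\<lambda>x. - u x) (\<lambda>i x. - g i x) (\<lambda>i x. - h i x)"
  by (intro second_partialsI DERIV_minus second_partialsD[OF assms])

lemma second_partials_add:
  assumes "second_partials u g h" "second_partials u' g' h'"
  shows "second_partials (\<lambda>x. u x + u' x) (\<lambda>i x. g i x + g' i x) (\<lambda>i x. h i x + h' i x)"
  by (intro second_partialsI DERIV_add second_partialsD[OF assms(1)] second_partialsD[OF assms(2)])

lemma second_partials_diff:
  assumes "second_partials u g h" "second_partials u' g' h'"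
  shows "second_partials (\<lambda>x. u x - u' x) (\<lambda>i x. g i x - g' i x) (\<lambda>i x. h i x - h' i x)"
  by (intro second_partialsI DERIV_diff second_partialsD[OF assms(1)] second_partialsD[OF assms(2)])

lemma second_partials_mult:
  assumes u: "second_partials u g h" and u': "second_partials u' g' h'"
  shows "second_partials (\<lambda>x. u x * u' x) (\<lambda>i x. g i x * u' x + g' i x * u x)
           (\<lambda>i x. h i x * u' x + 2 * g i x * g' i x + u x * h' i x)"
proof (rule second_partialsI)
  fix i x
  note D = second_partialsD[OF u, where x = x and i = i] second_partialsD[OF u', where x = x and i = i]
  show "((\<lambda>t. u (x + t *\<^sub>R axis i 1) * u' (x + t *\<^sub>R axis i 1)) has_real_derivative
          g i x * u' x + g' i x * u x) (at 0)"
    using DERIV_mult[OF D(1) D(3)] by simp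
  show "((\<lambda>t. g i (x + t *\<^sub>R axis i 1) * u' (x + t *\<^sub>R axis i 1)
            + g' i (x + t *\<^sub>R axis i 1) * u (x + t *\<^sub>R axis i 1)) has_real_derivative
          h i x * u' x + 2 * g i x * g' i x + u x * h' i x) (at 0)"
    using DERIV_add[OF DERIV_mult[OF D(2) D(3)] DERIV_mult[OF D(4) D(1)]]
    by (simp add: algebra_simps)
qed

lemma second_partials_compose:
  assumes u: "second_partials u g h"
    and F: "\<And>x. (F has_real_derivative F1 (u x)) (at (u x))"
    and F1: "\<And>x. (F1 has_real_derivative F2 (u x)) (at (u x))"
  shows "second_partials (\<lambda>x. F (u x)) (\<lambda>i x. F1 (u x) * g i x)
           (\<lambda>i x. F2 (u x) * (g i x)\<^sup>2 + F1 (u x) * h i x)"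
proof (rule second_partialsI)
  fix i x
  note D = second_partialsD[OF u, where x = x and i = i]
  show "((\<lambda>t. F (u (x + t *\<^sub>R axis i 1))) has_real_derivative F1 (u x) * g i x) (at 0)"
    by (rule DERIV_chain2[OF _ D(1)]) (simp add: F)
  have "((\<lambda>t. F1 (u (x + t *\<^sub>R axis i 1))) has_real_derivative F2 (u x) * g i x) (at 0)"
    by (rule DERIV_chain2[OF _ D(1)]) (simp add: F1)
  from DERIV_mult[OF this D(2)]
  show "((\<lambda>t. F1 (u (x + t *\<^sub>R axis i 1)) * g i (x + t *\<^sub>R axis i 1)) has_real_derivative
          F2 (u x) * (g i x)\<^sup>2 + F1 (u x) * h i x) (at 0)"
    by (simp add: power2_eq_square algebra_simps)
qed

lemma second_partials_const: "second_partials (\<lambda>x. c) (\<lambda>i x. 0) (\<lambda>i x. 0)"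
  by (intro second_partialsI) auto

lemma second_partials_nth:
  "second_partials (\<lambda>x. x $ m) (\<lambda>i x. if i = m then 1 else 0) (\<lambda>i x. 0)"
  by (intro second_partialsI) (auto simp: axis_def intro!: derivative_eq_intros)

lemma second_partials_quadratic:
  "second_partials (\<lambda>x. \<Sum>j\<in>UNIV. c j * (x $ j - y $ j)\<^sup>2)
     (\<lambda>i x. 2 * c i * (x $ i - y $ i)) (\<lambda>i x. 2 * c i)"
proof (intro second_partialsI)
  fix i x
  have "((\<lambda>t. \<Sum>j\<in>UNIV. c j * ((x + t *\<^sub>R axis i 1) $ j - y $ j)\<^sup>2) has_real_derivative
          (\<Sum>j\<in>UNIV. if j = i then 2 * c j * (x $ j - y $ j) else 0)) (at 0)"
    by (intro DERIV_sum) (auto simp: axis_def intro!: derivative_eq_intros)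
  then show "((\<lambda>t. \<Sum>j\<in>UNIV. c j * ((x + t *\<^sub>R axis i 1) $ j - y $ j)\<^sup>2) has_real_derivative
      2 * c i * (x $ i - y $ i)) (at 0)"
    by simp
  show "((\<lambda>t. 2 * c i * ((x + t *\<^sub>R axis i 1) $ i - y $ i)) has_real_derivative 2 * c i) (at 0)"
    by (auto simp: axis_def intro!: derivative_eq_intros)
qed

lemma norm_power2_vec: "(norm (x :: real ^ 'n))\<^sup>2 = (\<Sum>j\<in>UNIV. (x $ j)\<^sup>2)"
  unfolding power2_norm_eq_inner inner_vec_def by (simp add: power2_eq_square)

lemma second_partials_norm:
  "second_partials (\<lambda>x. (norm (x - y))\<^sup>2) (\<lambda>i x. 2 * (x $ i - y $ i)) (\<lambda>i x. 2)"
  using second_partials_quadratic[of "\<lambda>_. 1" y] by (simp add: norm_power2_vec)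

text \<open>If \<open>d > 0\<close>, then \<open>f1\<close> is positive just to the right of its
  zero, and the mean value theorem lifts \<open>f\<close> above \<open>f 0\<close>. The second
  derivative is used at the single point 0.\<close>

lemma second_derivative_at_max:
  fixes f :: "real \<Rightarrow> real"
  assumes f: "\<And>t. (f has_real_derivative f1 t) (at t)"
    and f1: "(f1 has_real_derivative d) (at 0)"
    and max: "0 < e" "\<And>t. \<bar>t\<bar> < e \<Longrightarrow> f t \<le> f 0"
  shows "f1 0 = 0" and "d \<le> 0"
proof -
  show 0: "f1 0 = 0"
    by (rule DERIV_local_max[OF f max(1)]) (use max(2) in auto)
  show "d \<le> 0"
  proof (rule ccontr)
    assume "\<not> d \<le> 0"
    then obtain r where r: "r > 0" "\<And>s. 0 < s \<Longrightarrow> s < r \<Longrightarrow> f1 0 < f1 (0 + s)"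
      using DERIV_pos_inc_right[OF f1] by auto
    define s where "s = min e r / 2"
    have s: "0 < s" "s < e" "s < r" using r(1) max(1) by (auto simp: s_def)
    obtain z where z: "0 < z" "z < s" "f s - f 0 = (s - 0) * f1 z"
      using MVT2[of 0 s f f1] f s by blast
    have "f1 z > 0" using r(2)[of z] z s 0 by simp
    then have "f s > f 0" using z s by (simp add: field_simps)
    with max(2)[of s] s show False by simp
  qed
qed

lemma second_partials_at_max:
  assumes u: "second_partials u g h"
    and max: "0 < e" "\<And>x. dist x p < e \<Longrightarrow> u x \<le> u p"
  shows "g i p = 0" and "h i p \<le> 0"
proof -
  let ?l = "\<lambda>t. p + t *\<^sub>R axis i (1::real)"
  have 1: "((\<lambda>t. u (?l t)) has_real_derivative g i (?l t)) (at t)" for t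
  proof -
    have "((\<lambda>s. u (?l t + s *\<^sub>R axis i 1)) has_real_derivative g i (?l t)) (at 0)"
      by (rule second_partialsD[OF u])
    then have "((\<lambda>s. u (?l (s + t))) has_real_derivative g i (?l t)) (at 0)"
      by (simp add: algebra_simps)
    then show ?thesis using DERIV_shift[of "\<lambda>t. u (?l t)" "g i (?l t)" 0 t] by simp
  qed
  have 2: "((\<lambda>t. g i (?l t)) has_real_derivative h i p) (at 0)"
    by (rule second_partialsD[OF u])
  have 3: "u (?l t) \<le> u (?l 0)" if "\<bar>t\<bar> < e" for t
    using max(2)[of "?l t"] that by (simp add: dist_norm)
  show "g i p = 0" "h i p \<le> 0"
    using second_derivative_at_max[OF 1 2 max(1) 3] by simp_all
qed

text \<open>The local step of every comparison: \<open>v\<close> presses against \<open>u\<close>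
  from below. Only the difference is maximal at \<open>p\<close>, so the two functions may differ
  there by a constant.\<close>

lemma laplacian_le_at_max:
  assumes u: "second_partials u g h" and v: "second_partials v g' h'"
    and max: "0 < e" "\<And>x. dist x p < e \<Longrightarrow> v x - u x \<le> v p - u p"
  shows "(\<Sum>i\<in>UNIV. h' i p) \<le> (\<Sum>i\<in>UNIV. h i p)"
  using second_partials_at_max(2)[OF second_partials_diff[OF v u] max]
  by (intro sum_mono) simp

section \<open>The one-dimensional profile and its derivatives\<close>

lemma H_odd: "H (- t) = - H t"
  by (simp add: H_def)

lemma H_less_1: "H t < 1" and H_gt_m1: "-1 < H t"
  by (simp_all add: H_def tanh_real_lt_1 tanh_real_gt_neg1)

lemma H_square_less_1: "(H t)\<^sup>2 < 1"
  using H_less_1[of t] H_gt_m1[of t] by (simp add: abs_square_less_1)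

lemma H_less_iff [simp]: "H s < H t \<longleftrightarrow> s < t" and H_le_iff [simp]: "H s \<le> H t \<longleftrightarrow> s \<le> t"
  by (simp_all add: H_def divide_less_cancel divide_le_cancel)

lemma H_0 [simp]: "H 0 = 0"
  by (simp add: H_def)

text \<open>The first integral \<open>H' = sqrt (2 W(H))\<close> of the profile equation, with
  \<open>W(s) = (1 - s^2)^2 / 4\<close>.\<close>

definition H1 :: "real \<Rightarrow> real" where "H1 t = (1 - (H t)\<^sup>2) / sqrt 2"

lemma H1_pos: "H1 t > 0"
  using H_square_less_1[of t] by (simp add: H1_def)

lemma DERIV_H: "(H has_real_derivative H1 t) (at t)"
  unfolding H_def[abs_def] H1_def
  by (rule derivative_eq_intros refl | simp add: H_def divide_simps mult.assoc)+

lemma DERIV_H1: "(H1 has_real_derivative - (sqrt 2 * H t * H1 t)) (at t)"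
  unfolding H1_def[abs_def]
  by (rule derivative_eq_intros DERIV_H refl | simp add: H1_def real_divide_square_eq field_simps)+

lemma continuous_on_H [continuous_intros]: "continuous_on A f \<Longrightarrow> continuous_on A (\<lambda>x. H (f x))"
  unfolding H_def by (intro continuous_intros) auto

lemma H_double_well: "H t - H t ^ 3 = sqrt 2 * H t * H1 t"
  by (simp add: H1_def field_simps power3_eq_cube power2_eq_square)

text \<open>The slope \<open>H1\<close> is at most 1; this converts a vertical gap below
  \<open>u\<close> into an admissible shift of the profile.\<close>

lemma H_add_le:
  assumes "0 \<le> d"
  shows "H (t + d) \<le> H t + d"
proof (cases "d = 0")
  case False
  then obtain z where "H (t + d) - H t = (t + d - t) * H1 z"
    using MVT2[of t "t + d" H H1] DERIV_H assms by force
  moreover have "H1 z \<le> 1"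
    using zero_le_power2[of "H z"] unfolding H1_def
    by (smt (verit) divide_le_eq_1 one_le_power real_sqrt_ge_1_iff)
  ultimately show ?thesis using assms mult_left_mono[of "H1 z" 1 d] by simp
qed simp

lemma H_tendsto_1: "(H \<longlongrightarrow> 1) at_top"
proof -
  have "filterlim (\<lambda>t::real. t / sqrt 2) at_top at_top"
    by (simp add: filterlim_at_top_mult_tendsto_pos[where c="1/sqrt 2"] filterlim_ident
      divide_inverse filterlim_tendsto_pos_mult_at_top filterlim_at_top_mult_tendsto_pos)
  then show ?thesis unfolding H_def[abs_def]
    by (rule filterlim_compose[OF tanh_real_at_top])
qed

lemma H_close_1:
  assumes "y < 1"
  obtains M where "M > 0" "\<And>t. M \<le> t \<Longrightarrow> y < H t"
proof -
  have "eventually (\<lambda>t. y < H t) at_top"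
    using order_tendstoD(1)[OF H_tendsto_1 assms] .
  then obtain M where "\<And>t. M \<le> t \<Longrightarrow> y < H t" by (auto simp: eventually_at_top_linorder)
  then show ?thesis using that[of "max M 1"] by simp
qed

text \<open>\<open>H \<circ> w\<close> is a strict subsolution when
  \<open>\<Delta>w > \<surd>2 H(w) (\<bar>\<nabla>w\<bar>\<^sup>2 - 1)\<close>: the profile equation \<open>H'' = H\<^sup>3 - H\<close> cancels the nonlinearity.\<close>
lemma second_partials_H:
  assumes "second_partials w g h"
  shows "second_partials (\<lambda>x. H (w x)) (\<lambda>i x. H1 (w x) * g i x)
     (\<lambda>i x. - (sqrt 2 * H (w x) * H1 (w x)) * (g i x)\<^sup>2 + H1 (w x) * h i x)"
  using second_partials_compose[OF assms DERIV_H DERIV_H1] .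

lemma second_partials_H_laplacian:
  "(\<Sum>i\<in>UNIV. - (sqrt 2 * H (w x) * H1 (w x)) * (g i x)\<^sup>2 + H1 (w x) * h i x) + (H (w x) - H (w x) ^ 3)
   = H1 (w x) * ((\<Sum>i\<in>UNIV. h i x) - sqrt 2 * H (w x) * ((\<Sum>i\<in>UNIV. (g i x)\<^sup>2) - 1))"
  unfolding H_double_well
  by (simp add: sum.distrib sum_distrib_left sum_negf sum_subtractf algebra_simps)

subsection \<open>Maximum principles\<close>

lemma attains_global_max:
  fixes f :: "'a::euclidean_space \<Rightarrow> real"
  assumes "continuous_on UNIV f" and out: "\<And>x. R < dist a x \<Longrightarrow> f x \<le> f a"
  shows "\<exists>p. \<forall>x. f x \<le> f p"
proof -
  have "compact (cball a (max R 0))" "cball a (max R 0) \<noteq> {}" by auto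
  moreover have "continuous_on (cball a (max R 0)) f"
    using assms(1) continuous_on_subset by blast
  ultimately have "\<exists>p\<in>cball a (max R 0). \<forall>x\<in>cball a (max R 0). f x \<le> f p"
    by (intro continuous_attains_sup)
  then obtain p where p: "\<And>x. dist a x \<le> max R 0 \<Longrightarrow> f x \<le> f p" by (meson mem_cball)
  have "f x \<le> f p" for x
    using p[of x] p[of a] out[of x] by fastforce
  then show ?thesis by blast
qed

text \<open>A Keller--Osserman type estimate: at a maximum of \<open>u (R\<^sup>2 - \<bar>x - x\<^sub>0\<bar>\<^sup>2)\<close> over a ball
  the cubic term controls \<open>u\<close>, and \<open>R \<rightarrow> \<infinity>\<close> removes the error.\<close>
lemma solution_le_1:
  fixes u :: "real ^ 'n::finite \<Rightarrow> real"
  assumes sp: "second_partials u g h" and cont: "continuous_on UNIV u"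
    and pde: "\<And>x. (\<Sum>i\<in>UNIV. h i x) = u x ^ 3 - u x"
  shows "u x0 \<le> 1"
proof (rule ccontr)
  assume "\<not> u x0 \<le> 1"
  then have gt: "u x0 > 1" by simp
  \<comment> \<open>Multiplying the second-order condition at the maximum \<open>p\<close> by
    \<open>\<eta> p\<close> and inserting the first-order one yields \<open>((u p)^2 - 1) (\<eta>
    p)^2 <= 8 |p - x0|^2 + 2 n \<eta> p <= C R^2\<close>, hence
    \<open>(u p \<eta> p)^2 <= R^4 + C R^2\<close>. The radius is chosen so that the value at the
    centre satisfies \<open>(u x0 R^2)^2 = R^4 + 2 C R^2\<close>.\<close>
  define C where "C = 8 + 2 * real CARD('n)"
  define R where "R = sqrt (2 * C / ((u x0)\<^sup>2 - 1))"
  have gt2: "(u x0)\<^sup>2 - 1 > 0" using gt by (simp add: one_less_power)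
  have C: "C > 0" by (simp add: C_def)
  have R: "R > 0" using C gt2 by (simp add: R_def)
  have R2: "R\<^sup>2 * ((u x0)\<^sup>2 - 1) = 2 * C" using C gt2 by (simp add: R_def)
  define \<eta> where "\<eta> = (\<lambda>x. R\<^sup>2 - (norm (x - x0))\<^sup>2)"
  have sp\<eta>: "second_partials \<eta> (\<lambda>i x. 0 - 2 * (x $ i - x0 $ i)) (\<lambda>i x. 0 - 2)"
    unfolding \<eta>_def by (intro second_partials_diff second_partials_const second_partials_norm)
  have cont\<eta>: "continuous_on UNIV \<eta>" unfolding \<eta>_def by (intro continuous_intros)
  have "continuous_on (cball x0 R) (\<lambda>x. u x * \<eta> x)"
    using continuous_on_mult[OF cont cont\<eta>] continuous_on_subset by blast
  then obtain p where p: "p \<in> cball x0 R" "\<And>x. x \<in> cball x0 R \<Longrightarrow> u x * \<eta> x \<le> u p * \<eta> p"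
    using continuous_attains_sup[of "cball x0 R" "\<lambda>x. u x * \<eta> x"] R by auto
  have big: "u p * \<eta> p \<ge> u x0 * R\<^sup>2" using p(2)[of x0] R by (simp add: \<eta>_def)
  have np: "norm (p - x0) \<le> R" using p(1) by (simp add: dist_norm norm_minus_commute)
  then have \<eta>0: "\<eta> p \<ge> 0" by (simp add: \<eta>_def power_mono)
  have pos: "u p * \<eta> p > 0" using big gt R by (smt (verit) mult_pos_pos zero_less_power)
  then have \<eta>p: "\<eta> p > 0" and up: "u p > 0" using \<eta>0 by (auto simp: zero_less_mult_iff)
  have "norm (p - x0) < R" using \<eta>p R by (simp add: \<eta>_def power2_less_imp_less)
  then have e: "0 < R - dist p x0" by (simp add: dist_norm)
  have loc: "u x * \<eta> x \<le> u p * \<eta> p" if "dist x p < R - dist p x0" for x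
    using p(2)[of x] that dist_triangle[of x x0 p] by (simp add: dist_commute)
  note M = second_partials_at_max[OF second_partials_mult[OF sp sp\<eta>] e loc]
  have g: "g i p * \<eta> p = 2 * (p $ i - x0 $ i) * u p" for i
    using M(1)[of i] by (simp add: algebra_simps)
  have "(\<Sum>i\<in>UNIV. h i p * \<eta> p + 2 * g i p * (- 2 * (p $ i - x0 $ i)) - 2 * u p) \<le> 0"
    using M(2) by (intro sum_nonpos) (simp add: algebra_simps)
  then have "(\<Sum>i\<in>UNIV. h i p * \<eta> p + 2 * g i p * (- 2 * (p $ i - x0 $ i)) - 2 * u p) * \<eta> p \<le> 0"
    using \<eta>p by (simp add: mult_nonpos_nonneg)
  also have "(\<Sum>i\<in>UNIV. h i p * \<eta> p + 2 * g i p * (- 2 * (p $ i - x0 $ i)) - 2 * u p) * \<eta> p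
     = (\<Sum>i\<in>UNIV. h i p * (\<eta> p)\<^sup>2 - 8 * u p * (p $ i - x0 $ i)\<^sup>2 - 2 * u p * \<eta> p)"
    unfolding sum_distrib_right
  proof (intro sum.cong refl)
    fix i
    have "(h i p * \<eta> p + 2 * g i p * (- 2 * (p $ i - x0 $ i)) - 2 * u p) * \<eta> p
      = h i p * (\<eta> p)\<^sup>2 - 4 * (p $ i - x0 $ i) * (g i p * \<eta> p) - 2 * u p * \<eta> p"
      by (simp add: power2_eq_square algebra_simps)
    then show "(h i p * \<eta> p + 2 * g i p * (- 2 * (p $ i - x0 $ i)) - 2 * u p) * \<eta> p
      = h i p * (\<eta> p)\<^sup>2 - 8 * u p * (p $ i - x0 $ i)\<^sup>2 - 2 * u p * \<eta> p"
      unfolding g by (simp add: power2_eq_square algebra_simps)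
  qed
  also have "\<dots> = (u p ^ 3 - u p) * (\<eta> p)\<^sup>2 - 8 * u p * (norm (p - x0))\<^sup>2 - 2 * real CARD('n) * u p * \<eta> p"
    by (simp add: sum_subtractf pde[symmetric] norm_power2_vec sum_distrib_left sum_distrib_right)
  also have "\<dots> = u p * (((u p)\<^sup>2 - 1) * (\<eta> p)\<^sup>2 - 8 * (norm (p - x0))\<^sup>2 - 2 * real CARD('n) * \<eta> p)"
    by (simp add: power2_eq_square power3_eq_cube algebra_simps)
  finally have "((u p)\<^sup>2 - 1) * (\<eta> p)\<^sup>2 - 8 * (norm (p - x0))\<^sup>2 - 2 * real CARD('n) * \<eta> p \<le> 0"
    using up by (simp add: mult_le_0_iff)
  moreover have r2: "(norm (p - x0))\<^sup>2 \<le> R\<^sup>2" using np by (simp add: power_mono)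
  moreover have \<eta>R: "\<eta> p \<le> R\<^sup>2" by (simp add: \<eta>_def)
  moreover have "2 * real CARD('n) * \<eta> p \<le> 2 * real CARD('n) * R\<^sup>2"
    using \<eta>R by (intro mult_left_mono) auto
  moreover have "((u p)\<^sup>2 - 1) * (\<eta> p)\<^sup>2 = (u p * \<eta> p)\<^sup>2 - (\<eta> p)\<^sup>2"
    "C * R\<^sup>2 = 8 * R\<^sup>2 + 2 * real CARD('n) * R\<^sup>2"
    by (simp_all add: C_def power_mult_distrib algebra_simps)
  ultimately have "(u p * \<eta> p)\<^sup>2 \<le> (\<eta> p)\<^sup>2 + C * R\<^sup>2" by linarith
  also have "(\<eta> p)\<^sup>2 \<le> (R\<^sup>2)\<^sup>2" using \<eta>R \<eta>0 by (rule power_mono)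
  finally have "(u p * \<eta> p)\<^sup>2 \<le> R\<^sup>2 * (R\<^sup>2 + C)" by (simp add: power2_eq_square algebra_simps)
  moreover have "(u x0 * R\<^sup>2)\<^sup>2 \<le> (u p * \<eta> p)\<^sup>2"
    using big gt by (intro power_mono) auto
  moreover have "(u x0 * R\<^sup>2)\<^sup>2 = R\<^sup>2 * (R\<^sup>2 + R\<^sup>2 * ((u x0)\<^sup>2 - 1))"
    by (simp add: power2_eq_square algebra_simps)
  ultimately have "R\<^sup>2 * (R\<^sup>2 + 2 * C) \<le> R\<^sup>2 * (R\<^sup>2 + C)" unfolding R2 by linarith
  moreover have "R\<^sup>2 * C > 0" using R C by simp
  ultimately show False by (simp add: distrib_left mult.commute)
qed

text \<open>Subtracting \<open>\<epsilon> |x - x0|^2\<close> forces a maximum \<open>p\<close> on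
  the unbounded domain. The Laplacian of this penalty is \<open>c d(x0) / 2\<close>, too small to
  balance \<open>c d(p) >= c d(x0)\<close>.\<close>

lemma bounded_maximum_principle:
  fixes d :: "real ^ 'n::finite \<Rightarrow> real"
  assumes sp: "second_partials d g h" and cont: "continuous_on UNIV d"
    and bd: "\<And>x. d x \<le> B" and c: "c > 0"
    and sub: "\<And>x. d x > 0 \<Longrightarrow> c * d x \<le> (\<Sum>i\<in>UNIV. h i x)"
  shows "d x0 \<le> 0"
proof (rule ccontr)
  assume "\<not> d x0 \<le> 0"
  then have d0: "d x0 > 0" by simp
  define N where "N = real CARD('n)"
  have N: "N > 0" by (simp add: N_def)
  define \<epsilon> where "\<epsilon> = c * d x0 / (4 * N)"
  have \<epsilon>: "\<epsilon> > 0" using c d0 N by (simp add: \<epsilon>_def)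
  have B: "B > 0" using bd[of x0] d0 by linarith
  let ?b = "\<lambda>x. \<epsilon> * (norm (x - x0))\<^sup>2"
  have spb: "second_partials ?b (\<lambda>i x. \<epsilon> * (2 * (x $ i - x0 $ i))) (\<lambda>i x. \<epsilon> * 2)"
    by (intro second_partials_cmult second_partials_norm)
  have "continuous_on UNIV (\<lambda>x. d x - ?b x)" by (intro continuous_intros cont)
  moreover have "d x - ?b x \<le> d x0 - ?b x0" if "sqrt (B / \<epsilon>) < dist x0 x" for x
  proof -
    have "(sqrt (B / \<epsilon>))\<^sup>2 \<le> (norm (x - x0))\<^sup>2"
      using that B \<epsilon> by (intro power_mono) (auto simp: dist_norm norm_minus_commute)
    then have "B \<le> ?b x" using B \<epsilon> by (simp add: field_simps)
    then show ?thesis using bd[of x] d0 by simp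
  qed
  ultimately obtain p where p: "\<And>x. d x - ?b x \<le> d p - ?b p"
    using attains_global_max[of "\<lambda>x. d x - ?b x"] by blast
  have "(\<Sum>i\<in>UNIV. h i p) \<le> (\<Sum>i\<in>(UNIV::'n set). \<epsilon> * 2)"
    by (rule laplacian_le_at_max[OF spb sp zero_less_one p])
  also have "\<dots> = 2 * N * \<epsilon>" by (simp add: N_def)
  also have "\<dots> = c * d x0 / 2" using N by (simp add: \<epsilon>_def)
  finally have "(\<Sum>i\<in>UNIV. h i p) \<le> c * d x0 / 2" .
  moreover have dp: "d p \<ge> d x0"
  proof -
    have "0 \<le> ?b p" using \<epsilon> by simp
    then show ?thesis using p[of x0] by simp
  qed
  moreover have "c * d p \<le> (\<Sum>i\<in>UNIV. h i p)" using sub[of p] dp d0 by linarith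
  moreover have "c * d x0 \<le> c * d p" using dp c by simp
  moreover have "c * d x0 > 0" using c d0 by simp
  ultimately show False by linarith
qed

text \<open>Barrier on a small ball around a zero \<open>p\<close> that is the only zero on the boundary of a ball
  \<open>B(y, \<rho>)\<close>: the function \<open>exp (-\<alpha> \<bar>x - y\<bar>\<^sup>2) - exp (-\<alpha> \<rho>\<^sup>2)\<close> lies below \<open>d\<close> on the boundary of
  the small ball, so by comparison the contact at \<open>p\<close> is impossible.\<close>
lemma strong_maximum_principle:
  fixes d :: "real ^ 'n::finite \<Rightarrow> real"
  assumes sp: "second_partials d g h" and cont: "continuous_on UNIV d"
    and nonneg: "\<And>x. d x \<ge> 0" and super: "\<And>x. (\<Sum>i\<in>UNIV. h i x) \<le> 2 * d x"
    and zero: "d z0 = 0"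
  shows "d x = 0"
proof (rule ccontr)
  assume "d x \<noteq> 0"
  define Z where "Z = {x. d x = 0}"
  have "closed Z" unfolding Z_def using cont by (intro closed_Collect_eq) auto
  moreover have "Z \<noteq> {}" using zero by (auto simp: Z_def)
  ultimately obtain p where p: "p \<in> Z" "\<And>z. z \<in> Z \<Longrightarrow> dist x p \<le> dist x z"
    using distance_attains_inf by blast
  have "x \<noteq> p" using p(1) \<open>d x \<noteq> 0\<close> by (auto simp: Z_def)
  \<comment> \<open>The open ball about \<open>x\<close> through the nearest zero \<open>p\<close>
    contains no zero. The ball of half the radius about the midpoint is internally tangent to it at
    \<open>p\<close>, so \<open>p\<close> is the only zero in its closure; the parallelogram law
    proves this.\<close>
  define \<rho> where "\<rho> = dist x p / 2"
  define y where "y = midpoint x p"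
  have \<rho>: "\<rho> > 0" using \<open>x \<noteq> p\<close> by (simp add: \<rho>_def)
  have py: "dist p y = \<rho>" by (simp add: \<rho>_def y_def dist_midpoint dist_commute)
  have only: "z = p" if "z \<in> Z" "dist z y \<le> \<rho>" for z
  proof -
    have a: "(norm (z - x))\<^sup>2 + (norm (z - p))\<^sup>2 = 2 * (norm (z - y))\<^sup>2 + 2 * (norm (p - y))\<^sup>2"
    proof -
      have 1: "z - x = (z - y) + (p - y)" and 2: "z - p = (z - y) - (p - y)"
        by (simp_all add: y_def midpoint_def algebra_simps flip: scaleR_add_left)
      have "(norm (v + w))\<^sup>2 + (norm (v - w))\<^sup>2 = 2 * (norm v)\<^sup>2 + 2 * (norm w)\<^sup>2" for v w :: "real ^ 'n"
        by (simp add: power2_norm_eq_inner inner_simps inner_commute)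
      then show ?thesis unfolding 1 2 .
    qed
    have "(norm (z - y))\<^sup>2 \<le> \<rho>\<^sup>2" using that(2) by (intro power_mono) (auto simp: dist_norm)
    moreover have "norm (p - y) = \<rho>" using py by (simp add: dist_norm)
    moreover have "(2 * \<rho>)\<^sup>2 \<le> (norm (z - x))\<^sup>2"
      using p(2)[OF that(1)] \<rho> by (intro power_mono) (auto simp: dist_norm \<rho>_def norm_minus_commute)
    ultimately have "(norm (z - p))\<^sup>2 \<le> 0" using a by (simp add: power2_eq_square)
    then show ?thesis by simp
  qed
  define N where "N = real CARD('n)"
  \<comment> \<open>Chosen so that the Laplacian of \<open>\<zeta>\<close> is at least
    \<open>3 e > 2 \<zeta>\<close> wherever \<open>|x - y| >= \<rho> / 2\<close>, which covers the
    ball of radius \<open>\<rho> / 2\<close> about \<open>p\<close>.\<close>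
  define \<alpha> where "\<alpha> = (2 * N + 3) / \<rho>\<^sup>2 + 1"
  have \<alpha>1: "\<alpha> \<ge> 1" using \<rho> by (simp add: \<alpha>_def N_def)
  have \<alpha>2: "\<alpha> * \<rho>\<^sup>2 - 2 * N \<ge> 3" using \<rho> by (simp add: \<alpha>_def field_simps)
  have "3 \<le> \<alpha> * (\<alpha> * \<rho>\<^sup>2 - 2 * N)" using mult_mono[OF \<alpha>1 \<alpha>2] \<alpha>1 by simp
  then have \<alpha>3: "\<alpha>\<^sup>2 * \<rho>\<^sup>2 - 2 * N * \<alpha> \<ge> 3" by (simp add: power2_eq_square algebra_simps)
  define e where "e = (\<lambda>x. exp (- (\<alpha> * (norm (x - y))\<^sup>2)))"
  define \<zeta> where "\<zeta> = (\<lambda>x. e x - exp (- (\<alpha> * \<rho>\<^sup>2)))"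
  have "second_partials (\<lambda>x. exp (- (\<alpha> * (norm (x - y))\<^sup>2)) - exp (- (\<alpha> * \<rho>\<^sup>2)))
     (\<lambda>i x. - (\<alpha> * exp (- (\<alpha> * (norm (x - y))\<^sup>2))) * (2 * (x $ i - y $ i)))
     (\<lambda>i x. \<alpha>\<^sup>2 * exp (- (\<alpha> * (norm (x - y))\<^sup>2)) * (2 * (x $ i - y $ i))\<^sup>2
            + - (\<alpha> * exp (- (\<alpha> * (norm (x - y))\<^sup>2))) * 2)"
    by (rule second_partials_compose[OF second_partials_norm,
          of "\<lambda>s. exp (- (\<alpha> * s)) - exp (- (\<alpha> * \<rho>\<^sup>2))" "\<lambda>s. - (\<alpha> * exp (- (\<alpha> * s)))" y
             "\<lambda>s. \<alpha>\<^sup>2 * exp (- (\<alpha> * s))"])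
       (auto intro!: derivative_eq_intros simp: power2_eq_square)
  then have sp\<zeta>: "second_partials \<zeta> (\<lambda>i x. - (\<alpha> * e x) * (2 * (x $ i - y $ i)))
     (\<lambda>i x. \<alpha>\<^sup>2 * e x * (2 * (x $ i - y $ i))\<^sup>2 + - (\<alpha> * e x) * 2)"
    by (simp add: \<zeta>_def e_def)
  have e0: "e x > 0" and e1: "e x \<le> 1" for x using \<alpha>1 by (simp_all add: e_def)
  have \<zeta>less: "\<zeta> x < e x" for x by (simp add: \<zeta>_def)
  have lap: "(\<Sum>i\<in>UNIV. \<alpha>\<^sup>2 * e x * (2 * (x $ i - y $ i))\<^sup>2 + - (\<alpha> * e x) * 2) > 2 * \<zeta> x"
    if "\<rho> / 2 \<le> dist x y" for x
  proof -
    have "(\<rho> / 2)\<^sup>2 \<le> (norm (x - y))\<^sup>2" using that \<rho> by (intro power_mono) (auto simp: dist_norm)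
    then have r: "\<rho>\<^sup>2 \<le> 4 * (norm (x - y))\<^sup>2" by (simp add: power_divide)
    have "(\<Sum>i\<in>UNIV. \<alpha>\<^sup>2 * e x * (2 * (x $ i - y $ i))\<^sup>2 + - (\<alpha> * e x) * 2)
       = e x * (\<alpha>\<^sup>2 * (4 * (norm (x - y))\<^sup>2) - 2 * N * \<alpha>)"
      unfolding sum.distrib norm_power2_vec power_mult_distrib
      by (simp add: sum_distrib_left N_def right_diff_distrib mult_ac)
    also have "\<dots> \<ge> e x * (\<alpha>\<^sup>2 * \<rho>\<^sup>2 - 2 * N * \<alpha>)"
      using r e0[of x] by (intro mult_left_mono diff_right_mono) auto
    also have "e x * (\<alpha>\<^sup>2 * \<rho>\<^sup>2 - 2 * N * \<alpha>) \<ge> e x * 3"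
      using \<alpha>3 e0[of x] by (intro mult_left_mono) auto
    finally show ?thesis using \<zeta>less[of x] e0[of x] by linarith
  qed
  \<comment> \<open>On the rest of the small sphere \<open>\<zeta> < 0 <= d\<close>, so only here is
    a positive lower bound \<open>m\<close> for \<open>d\<close> required;
    \<open>\<zeta> < 1\<close> then gives \<open>\<kappa> \<zeta> < m <= d\<close> with
    \<open>\<kappa> = m / 2\<close>.\<close>
  define K where "K = sphere p (\<rho> / 2) \<inter> cball y \<rho>"
  have "compact K" by (simp add: K_def compact_Int)
  have dK: "d x > 0" if "x \<in> K" for x
  proof -
    have "dist x y \<le> \<rho>" "x \<noteq> p" using that \<rho> by (auto simp: K_def dist_commute)
    then have "x \<notin> Z" using only by blast
    then show ?thesis using nonneg[of x] by (simp add: Z_def less_le)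
  qed
  obtain m where m: "m > 0" "\<And>x. x \<in> K \<Longrightarrow> m \<le> d x"
  proof (cases "K = {}")
    case False
    moreover have "continuous_on K d" using cont continuous_on_subset by blast
    ultimately obtain q where "q \<in> K" "\<And>x. x \<in> K \<Longrightarrow> d q \<le> d x"
      using continuous_attains_inf[OF \<open>compact K\<close>, of d] by metis
    then show ?thesis using that[OF dK] by blast
  next
    case True
    show ?thesis by (rule that[of 1]) (simp_all add: True)
  qed
  define \<kappa> where "\<kappa> = m / 2"
  have \<kappa>: "\<kappa> > 0" using m by (simp add: \<kappa>_def)
  have cont': "continuous_on (cball p (\<rho> / 2)) (\<lambda>x. \<kappa> * \<zeta> x - d x)"
    unfolding \<zeta>_def e_def
    by (intro continuous_intros continuous_on_subset[OF cont]) auto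
  obtain q where q: "q \<in> cball p (\<rho> / 2)"
    "\<And>x. x \<in> cball p (\<rho> / 2) \<Longrightarrow> \<kappa> * \<zeta> x - d x \<le> \<kappa> * \<zeta> q - d q"
    using continuous_attains_sup[OF compact_cball _ cont'] \<rho>
    by (metis cball_eq_empty less_eq_real_def half_gt_zero not_less)
  have "\<zeta> p = 0" using py by (simp add: \<zeta>_def e_def dist_norm)
  then have q0: "\<kappa> * \<zeta> q - d q \<ge> 0" using q(2)[of p] p(1) \<rho> by (simp add: Z_def)
  have "dist p q \<noteq> \<rho> / 2"
  proof
    assume b: "dist p q = \<rho> / 2"
    show False
    proof (cases "dist y q \<le> \<rho>")
      case True
      then have "m \<le> d q" using b m(2) by (simp add: K_def)
      moreover have "\<kappa> * \<zeta> q < \<kappa> * 1"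
        using \<zeta>less[of q] e1[of q] \<kappa> by (intro mult_strict_left_mono) auto
      moreover have "\<kappa> < m" using m(1) by (simp add: \<kappa>_def)
      ultimately show False using q0 by linarith
    next
      case False
      then have "\<rho>\<^sup>2 < (norm (q - y))\<^sup>2"
        using \<rho> by (intro power_strict_mono) (auto simp: dist_norm norm_minus_commute)
      then have "\<zeta> q < 0" using \<alpha>1 by (simp add: \<zeta>_def e_def)
      then have "\<kappa> * \<zeta> q < 0" using \<kappa> by (simp add: mult_pos_neg)
      then show False using q0 nonneg[of q] by linarith
    qed
  qed
  then have r: "0 < \<rho> / 2 - dist p q" using q(1) by simp
  have loc: "\<kappa> * \<zeta> x - d x \<le> \<kappa> * \<zeta> q - d q" if "dist x q < \<rho> / 2 - dist p q" for x
    using q(2)[of x] that dist_triangle[of p x q] by (simp add: dist_commute)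
  have "\<rho> / 2 \<le> dist q y" using dist_triangle[of p y q] r py by linarith
  from lap[OF this] have "\<kappa> * (2 * \<zeta> q) < \<kappa> * (\<Sum>i\<in>UNIV. \<alpha>\<^sup>2 * e q * (2 * (q $ i - y $ i))\<^sup>2 + - (\<alpha> * e q) * 2)"
    using \<kappa> by (intro mult_strict_left_mono)
  also have "\<dots> \<le> (\<Sum>i\<in>UNIV. h i q)"
    using laplacian_le_at_max[OF sp second_partials_cmult[OF sp\<zeta>] r loc]
    by (simp add: sum_distrib_left)
  also have "\<dots> \<le> 2 * d q" by (rule super)
  finally show False using q0 by simp
qed

subsection \<open>Comparison with one-dimensional profiles\<close>

text \<open>Minimise the parameter over the compact set of pairs with \<open>F >= 0\<close>. If
  \<open>F s x > 0\<close> at the minimal \<open>s\<close>, the intermediate value theorem gives a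
  zero at a strictly smaller parameter. Minimality thus replaces monotonicity of \<open>F\<close> in
  the parameter.\<close>

lemma first_contact:
  fixes F :: "real \<Rightarrow> 'a::metric_space \<Rightarrow> real"
  assumes K: "compact K" and cont: "continuous_on ({0..b} \<times> K) (\<lambda>z. F (fst z) (snd z))"
    and start: "\<And>x. x \<in> K \<Longrightarrow> F 0 x < 0" and b: "0 \<le> b" and q: "q \<in> K" "F b q \<ge> 0"
  shows "\<exists>s p. 0 \<le> s \<and> s \<le> b \<and> p \<in> K \<and> F s p = 0 \<and> (\<forall>x\<in>K. F s x \<le> 0)"
proof -
  define S where "S = {0..b} \<times> K"
  define Bad where "Bad = S \<inter> (\<lambda>z. F (fst z) (snd z)) -` {0..}"
  have S: "compact S" unfolding S_def using K by (intro compact_Times) auto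
  have "closed Bad" unfolding Bad_def
    using cont compact_imp_closed[OF S] by (intro continuous_closed_preimage) (auto simp: S_def)
  moreover have "Bad = S \<inter> Bad" by (auto simp: Bad_def)
  ultimately have "compact Bad" using compact_Int_closed[OF S] by metis
  moreover have "(b, q) \<in> Bad" using b q by (simp add: Bad_def S_def)
  then have "Bad \<noteq> {}" by blast
  moreover have "continuous_on Bad fst" by (intro continuous_intros)
  ultimately have "\<exists>z\<in>Bad. \<forall>z'\<in>Bad. fst z \<le> fst z'"
    by (intro continuous_attains_inf)
  then obtain s p where sp: "(s, p) \<in> Bad" and min: "\<And>t x. (t, x) \<in> Bad \<Longrightarrow> s \<le> t"
    by fastforce
  have s: "0 \<le> s" "s \<le> b" "p \<in> K" "F s p \<ge> 0" using sp by (auto simp: Bad_def S_def)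
  have le: "F s x \<le> 0" if x: "x \<in> K" for x
  proof (rule ccontr)
    assume "\<not> F s x \<le> 0"
    have "continuous_on {0..s} (\<lambda>t. F (fst (t, x)) (snd (t, x)))"
      by (rule continuous_on_compose2[OF cont]) (use x s in \<open>auto intro!: continuous_intros\<close>)
    then obtain t where t: "0 \<le> t" "t \<le> s" "F t x = 0"
      using IVT'[of "\<lambda>t. F t x" 0 0 s] start[OF x] \<open>\<not> F s x \<le> 0\<close> s(1) by auto
    then have "(t, x) \<in> Bad" using x s by (simp add: Bad_def S_def)
    then have "t = s" using min t by fastforce
    then show False using t \<open>\<not> F s x \<le> 0\<close> by simp
  qed
  show ?thesis
    using s(1-3) antisym[OF le[OF s(3)] s(4)] le by blast
qed

text \<open>Both values lie beyond the same threshold, so the difference quotient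
  \<open>v^2 + u v + u^2 - 1\<close> is at least \<open>3 81/100 - 1 > 1\<close>. This is the
  coercivity behind the comparisons near 1 and near -1.\<close>

lemma cubic_increment:
  fixes u v :: real
  assumes "u < v" and "9/10 \<le> u \<or> v \<le> - (9/10)"
  shows "v - u \<le> (v ^ 3 - v) - (u ^ 3 - u)"
proof -
  have "81/100 \<le> u\<^sup>2 \<and> 81/100 \<le> v\<^sup>2 \<and> 81/100 \<le> u * v"
    using assms(2)
  proof
    assume u: "9/10 \<le> u"
    then have "(9/10) * (9/10) \<le> u * u" "(9/10) * (9/10) \<le> v * v" "(9/10) * (9/10) \<le> u * v"
      using assms(1) by (intro mult_mono; linarith)+
    then show ?thesis by (simp add: power2_eq_square)
  next
    assume v: "v \<le> - (9/10)"
    then have "(9/10) * (9/10) \<le> (- u) * (- u)" "(9/10) * (9/10) \<le> (- v) * (- v)"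
      "(9/10) * (9/10) \<le> (- u) * (- v)"
      using assms(1) by (intro mult_mono; linarith)+
    then show ?thesis by (simp add: power2_eq_square)
  qed
  then have "(v - u) * 1 \<le> (v - u) * (v\<^sup>2 + u * v + u\<^sup>2 - 1)"
    using assms(1) by (intro mult_left_mono) auto
  also have "\<dots> = (v ^ 3 - v) - (u ^ 3 - u)"
    by (simp add: power2_eq_square power3_eq_cube algebra_simps)
  finally show ?thesis by simp
qed

lemma profile_solution:
  fixes m :: "'n::finite"
  shows "\<exists>g h. second_partials (\<lambda>x :: real ^ 'n. H (a - x $ m)) g h \<and>
    (\<forall>x. (\<Sum>i\<in>UNIV. h i x) = H (a - x $ m) ^ 3 - H (a - x $ m))"
proof -
  let ?g = "\<lambda>i x. 0 - (if i = m then 1 else 0 :: real)" and ?h = "\<lambda>i x. 0 - (0 :: real)"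
  let ?w = "\<lambda>x :: real ^ 'n. a - x $ m"
  have sp: "second_partials ?w ?g ?h"
    by (intro second_partials_diff second_partials_const second_partials_nth)
  have eq: "(\<Sum>i\<in>UNIV. - (sqrt 2 * H (?w x) * H1 (?w x)) * (?g i x)\<^sup>2 + H1 (?w x) * ?h i x)
      + (H (?w x) - H (?w x) ^ 3) = 0" for x
  proof -
    have "(\<Sum>i\<in>(UNIV :: 'n set). (?g i x)\<^sup>2) = (\<Sum>i\<in>UNIV. if i = m then 1 else 0)"
      by (intro sum.cong) auto
    then show ?thesis
      using second_partials_H_laplacian[where w = ?w and g = ?g and h = ?h and x = x] by simp
  qed
  then have "(\<Sum>i\<in>UNIV. - (sqrt 2 * H (?w x) * H1 (?w x)) * (?g i x)\<^sup>2 + H1 (?w x) * ?h i x)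
      = H (?w x) ^ 3 - H (?w x)" for x
    using eq[of x] by linarith
  then show ?thesis using second_partials_H[OF sp] by blast
qed

lemma continuous_on_profile: "continuous_on UNIV (\<lambda>x. H (a - x $ m))"
  by (intro continuous_intros)

text \<open>Since \<open>(s - s\<^sup>3) / s\<close> decreases, all multiples \<open>s \<phi>\<close>, \<open>s \<in> (0, 1)\<close>, of a positive subsolution \<open>\<phi>\<close>
  on a ball are strict subsolutions, so \<open>u \<ge> \<phi>\<close> there. Here
  \<open>\<phi> = H (c (1 - \<bar>x - x\<^sub>0\<bar>\<^sup>2 / R\<^sup>2)\<^sup>2)\<close>; the square makes it a subsolution up to the boundary.\<close>
lemma positive_solution_near_1:
  fixes u :: "real ^ 'n::finite \<Rightarrow> real"
  assumes sp: "second_partials u g h" and cont: "continuous_on UNIV u"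
    and pde: "\<And>x. (\<Sum>i\<in>UNIV. h i x) = u x ^ 3 - u x"
    and pos: "\<And>x. x $ m \<le> 0 \<Longrightarrow> u x > 0" and card: "CARD('n) \<le> 3"
  obtains T where "\<And>x. x $ m \<le> - T \<Longrightarrow> 9/10 \<le> u x"
proof -
  obtain c where c: "c > 0" "9/10 < H c" using H_close_1[of "9/10"] by auto
  \<comment> \<open>\<open>X\<close> is \<open>1 / R^2\<close>. The first bound keeps the squared
    gradient of \<open>w\<close> below 1/2, which leaves a gain of \<open>H (w y) / 2\<close>. The
    Laplacian of \<open>w\<close> is at least \<open>c X (8 - 20 \<eta>)\<close>, which can be
    negative only where \<open>\<eta> > 2/5\<close>; there \<open>w >= c / 16\<close>, and by the
    second bound the gain outweighs the loss of at most \<open>12 c X\<close>.\<close>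
  define X where "X = min (1 / (32 * c\<^sup>2)) (H (c / 16) / (30 * c))"
  have Hc: "H (c / 16) > 0" using c H_less_iff[of 0 "c/16"] by simp
  have X: "X > 0" using c Hc by (simp add: X_def)
  have X1: "16 * c\<^sup>2 * X \<le> 1/2"
  proof -
    have "X \<le> 1 / (32 * c\<^sup>2)" by (simp add: X_def)
    then show ?thesis using c by (simp add: field_simps)
  qed
  have X2: "15 * (c * X) \<le> H (c / 16) / 2"
  proof -
    have "X \<le> H (c / 16) / (30 * c)" by (simp add: X_def)
    then show ?thesis using c by (simp add: field_simps)
  qed
  define R where "R = 1 / sqrt X"
  have R: "R > 0" "X * R\<^sup>2 = 1" using X by (simp_all add: R_def power_divide)
  have "9/10 \<le> u x0" if x0: "x0 $ m \<le> - R" for x0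
  proof (rule ccontr)
    assume "\<not> 9/10 \<le> u x0"
    have ball_pos: "u y > 0" if "y \<in> cball x0 R" for y
    proof -
      have "\<bar>(y - x0) $ m\<bar> \<le> R"
        using component_le_norm_cart[of "y - x0" m] that by (simp add: dist_norm norm_minus_commute)
      then show ?thesis using x0 pos[of y] by simp
    qed
    define \<eta> where "\<eta> = (\<lambda>y. 1 - X * (norm (y - x0))\<^sup>2)"
    define w where "w = (\<lambda>y. c * (\<eta> y)\<^sup>2)"
    define gw where "gw = (\<lambda>i y. - (2 * c * X * \<eta> y) * (2 * (y $ i - x0 $ i)))"
    define hw where "hw = (\<lambda>i y. (2 * c * X\<^sup>2) * (2 * (y $ i - x0 $ i))\<^sup>2 + - (2 * c * X * \<eta> y) * 2)"
    have spw: "second_partials w gw hw"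
      unfolding w_def \<eta>_def gw_def hw_def
      by (rule second_partials_compose[OF second_partials_norm,
            of "\<lambda>t. c * (1 - X * t)\<^sup>2" "\<lambda>t. - (2 * c * X * (1 - X * t))" x0 "\<lambda>t. 2 * c * X\<^sup>2"])
         (auto intro!: derivative_eq_intros simp: power2_eq_square)
    define \<phi> where "\<phi> = (\<lambda>y. H (w y))"
    define h\<phi> where "h\<phi> = (\<lambda>i y. - (sqrt 2 * H (w y) * H1 (w y)) * (gw i y)\<^sup>2 + H1 (w y) * hw i y)"
    have sp\<phi>: "second_partials \<phi> (\<lambda>i y. H1 (w y) * gw i y) h\<phi>"
      unfolding \<phi>_def h\<phi>_def by (rule second_partials_H[OF spw])
    have sub: "(\<Sum>i\<in>UNIV. h\<phi> i y) + (\<phi> y - \<phi> y ^ 3) > 0" if "0 < \<eta> y" for y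
    proof -
      have Xr: "X * (norm (y - x0))\<^sup>2 = 1 - \<eta> y" by (simp add: \<eta>_def)
      have \<eta>1: "\<eta> y \<le> 1" using X by (simp add: \<eta>_def)
      have "(\<Sum>i\<in>UNIV. (gw i y)\<^sup>2) = 16 * c\<^sup>2 * X * (\<eta> y)\<^sup>2 * (X * (norm (y - x0))\<^sup>2)"
        unfolding norm_power2_vec gw_def sum_distrib_left
        by (intro sum.cong refl) (simp add: power2_eq_square algebra_simps)
      also have "\<dots> = (16 * c\<^sup>2 * X) * ((\<eta> y)\<^sup>2 * (1 - \<eta> y))" unfolding Xr by simp
      also have "\<dots> \<le> (1/2) * (1 * 1)"
        using X1 \<eta>1 that X c by (intro mult_mono) (auto simp: power_le_one)
      finally have G: "(\<Sum>i\<in>UNIV. (gw i y)\<^sup>2) \<le> 1/2" by simp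
      have "(\<Sum>i\<in>UNIV. hw i y) = 8 * c * X * (X * (norm (y - x0))\<^sup>2) - 4 * real CARD('n) * (c * X * \<eta> y)"
        unfolding norm_power2_vec hw_def sum.distrib sum_distrib_left power_mult_distrib
        by (simp add: power2_eq_square right_diff_distrib left_diff_distrib mult_ac)
      also have "\<dots> \<ge> 8 * c * X * (1 - \<eta> y) - 12 * (c * X * \<eta> y)"
      proof -
        have "4 * real CARD('n) * (c * X * \<eta> y) \<le> 12 * (c * X * \<eta> y)"
          using card c X that by (intro mult_right_mono) auto
        then show ?thesis unfolding Xr by linarith
      qed
      finally have L: "(\<Sum>i\<in>UNIV. hw i y) \<ge> c * X * (8 - 20 * \<eta> y)" by (simp add: algebra_simps)
      have Hw: "H (w y) > 0" using c that H_less_iff[of 0 "w y"] by (simp add: w_def)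
      have "H (w y) * (1/2) \<le> (sqrt 2 * H (w y)) * (1 - (\<Sum>i\<in>UNIV. (gw i y)\<^sup>2))"
        using Hw G by (intro mult_mono) auto
      then have B: "(\<Sum>i\<in>UNIV. hw i y) - sqrt 2 * H (w y) * ((\<Sum>i\<in>UNIV. (gw i y)\<^sup>2) - 1)
          \<ge> c * X * (8 - 20 * \<eta> y) + H (w y) / 2"
        using L by (simp add: algebra_simps)
      have "c * X * (8 - 20 * \<eta> y) + H (w y) / 2 > 0"
      proof (cases "\<eta> y < 2/5")
        case True
        then have "c * X * (8 - 20 * \<eta> y) > 0" using c X by simp
        then show ?thesis using Hw by simp
      next
        case False
        then have "(1/4)\<^sup>2 \<le> (\<eta> y)\<^sup>2" by (intro power_mono) auto
        then have "c / 16 \<le> w y" using c by (simp add: w_def power2_eq_square)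
        then have "H (c / 16) \<le> H (w y)" by simp
        moreover have "c * X * (8 - 20 * \<eta> y) \<ge> c * X * (- 12)"
          using c X \<eta>1 by (intro mult_left_mono) auto
        moreover have "c * X > 0" using c X by simp
        ultimately show ?thesis using X2 by linarith
      qed
      then have "H1 (w y) * ((\<Sum>i\<in>UNIV. hw i y) - sqrt 2 * H (w y) * ((\<Sum>i\<in>UNIV. (gw i y)\<^sup>2) - 1)) > 0"
        using B H1_pos[of "w y"] by (intro mult_pos_pos) auto
      then show ?thesis unfolding \<phi>_def h\<phi>_def second_partials_H_laplacian .
    qed
    \<comment> \<open>Maximising the quotient finds the critical multiple at once: with
      \<open>s = u p / \<phi> p < 1\<close>, \<open>s \<phi>\<close> touches \<open>u\<close> from
      below at \<open>p\<close>. The point is interior because \<open>\<phi>\<close> vanishes on the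
      sphere.\<close>
    have "continuous_on (cball x0 R) (\<lambda>y. \<phi> y / u y)"
      unfolding \<phi>_def w_def \<eta>_def using ball_pos
      by (intro continuous_intros continuous_on_subset[OF cont]) force+
    then have "\<exists>p\<in>cball x0 R. \<forall>y\<in>cball x0 R. \<phi> y / u y \<le> \<phi> p / u p"
      using R by (intro continuous_attains_sup) auto
    then obtain p where p: "p \<in> cball x0 R" and pmax: "\<And>y. y \<in> cball x0 R \<Longrightarrow> \<phi> y / u y \<le> \<phi> p / u p"
      by meson
    have up: "u p > 0" using ball_pos p by blast
    have x0b: "x0 \<in> cball x0 R" using R by simp
    have "\<phi> x0 = H c" by (simp add: \<phi>_def w_def \<eta>_def)
    then have "\<phi> x0 / u x0 > 1" using c \<open>\<not> 9/10 \<le> u x0\<close> ball_pos[OF x0b] by simp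
    then have M1: "\<phi> p / u p > 1" using pmax[OF x0b] by linarith
    then have \<phi>p: "\<phi> p > u p" using up by simp
    define s where "s = u p / \<phi> p"
    have s: "0 < s" "s < 1" "s * \<phi> p = u p" using \<phi>p up by (simp_all add: s_def)
    have below: "s * \<phi> y \<le> u y" if "y \<in> cball x0 R" for y
      using pmax[OF that] ball_pos[OF that] up \<phi>p by (simp add: s_def field_simps)
    have np: "norm (p - x0) \<le> R" using p by (simp add: dist_norm norm_minus_commute)
    have \<eta>p: "\<eta> p > 0"
    proof -
      have "X * (norm (p - x0))\<^sup>2 \<le> X * R\<^sup>2" using np X by (intro mult_left_mono power_mono) auto
      then have "\<eta> p \<ge> 0" using R by (simp add: \<eta>_def)
      moreover have "\<eta> p \<noteq> 0" using \<phi>p up by (auto simp: \<phi>_def w_def)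
      ultimately show ?thesis by simp
    qed
    have "norm (p - x0) \<noteq> R" using \<eta>p R(2) by (auto simp: \<eta>_def)
    then have e: "0 < R - dist x0 p" using np by (simp add: dist_norm norm_minus_commute)
    have loc: "s * \<phi> y - u y \<le> s * \<phi> p - u p" if "dist y p < R - dist x0 p" for y
      using below[of y] that dist_triangle[of x0 y p] s(3) by (simp add: dist_commute)
    have "s * (\<Sum>i\<in>UNIV. h\<phi> i p) \<le> u p ^ 3 - u p"
      using laplacian_le_at_max[OF sp second_partials_cmult[OF sp\<phi>] e loc]
      by (simp add: sum_distrib_left pde)
    also have "\<dots> = s * (s\<^sup>2 * \<phi> p ^ 3 - \<phi> p)"
      unfolding s(3)[symmetric] by (simp add: power2_eq_square power3_eq_cube algebra_simps)
    also have "\<dots> \<le> s * (\<phi> p ^ 3 - \<phi> p)"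
      using s up \<phi>p by (intro mult_left_mono diff_right_mono mult_left_le_one_le) (auto simp: power_le_one)
    finally have "(\<Sum>i\<in>UNIV. h\<phi> i p) \<le> \<phi> p ^ 3 - \<phi> p" using s(1) by simp
    then show False using sub[OF \<eta>p] by linarith
  qed
  then show ?thesis by (rule that)
qed

text \<open>The shift puts the transition of the profile so far left that every point satisfies one
  alternative of \<open>cubic_increment\<close>: \<open>u >= 9/10\<close> for
  \<open>x $ m <= - T\<close>, and the profile is at most -9/10 elsewhere.\<close>

lemma above_some_profile:
  fixes u :: "real ^ 'n::finite \<Rightarrow> real"
  assumes sp: "second_partials u g h" and cont: "continuous_on UNIV u"
    and pde: "\<And>x. (\<Sum>i\<in>UNIV. h i x) = u x ^ 3 - u x"
    and low: "\<And>x. -1 \<le> u x" and T: "\<And>x. x $ m \<le> - T \<Longrightarrow> 9/10 \<le> u x"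
  obtains a where "\<And>x. H (a - x $ m) \<le> u x"
proof -
  obtain M where M: "9/10 < H M" using H_close_1[of "9/10"] by auto
  define a where "a = - T - M"
  let ?v = "\<lambda>x. H (a - x $ m)"
  obtain g' h' where v: "second_partials ?v g' h'" "\<And>x. (\<Sum>i\<in>UNIV. h' i x) = ?v x ^ 3 - ?v x"
    using profile_solution[of a m] by blast
  have sub: "1 * (?v x - u x) \<le> (\<Sum>i\<in>UNIV. h' i x - h i x)" if "?v x - u x > 0" for x
  proof -
    have "?v x \<le> - (9/10)" if "\<not> x $ m \<le> - T"
    proof -
      have "?v x \<le> H (- M)" using that by (simp add: a_def)
      then show ?thesis using M by (simp add: H_odd)
    qed
    then have "9/10 \<le> u x \<or> ?v x \<le> - (9/10)" using T[of x] by blast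
    then show ?thesis using cubic_increment[of "u x" "?v x"] that by (simp add: sum_subtractf v(2) pde)
  qed
  have bd: "?v x - u x \<le> 2" for x using H_less_1[of "a - x $ m"] low[of x] by linarith
  have "?v x - u x \<le> 0" for x
    by (rule bounded_maximum_principle[OF second_partials_diff[OF v(1) sp] _ bd zero_less_one sub])
       (intro continuous_intros cont)
  then show ?thesis using that[of a] by simp
qed

text \<open>The Laplacian of \<open>d = u - v\<close> is \<open>(u^2 + u v + v^2 - 1) d\<close>, and
  the coefficient is at most 2 for values in \<open>[-1, 1]\<close>; this is the constant in the
  strong maximum principle.\<close>

lemma touching_solutions_eq:
  fixes u v :: "real ^ 'n::finite \<Rightarrow> real"
  assumes u: "second_partials u g h" "continuous_on UNIV u"
      "\<And>x. (\<Sum>i\<in>UNIV. h i x) = u x ^ 3 - u x" "\<And>x. \<bar>u x\<bar> \<le> 1"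
    and v: "second_partials v g' h'" "continuous_on UNIV v"
      "\<And>x. (\<Sum>i\<in>UNIV. h' i x) = v x ^ 3 - v x" "\<And>x. \<bar>v x\<bar> \<le> 1"
    and le: "\<And>x. v x \<le> u x" and eq: "u z = v z"
  shows "u x = v x"
proof -
  have "u x - v x = 0"
  proof (rule strong_maximum_principle[OF second_partials_diff[OF u(1) v(1)]])
    show "continuous_on UNIV (\<lambda>x. u x - v x)" by (intro continuous_intros u v)
    show "0 \<le> u x - v x" for x using le by simp
    show "u z - v z = 0" using eq by simp
    show "(\<Sum>i\<in>UNIV. h i x - h' i x) \<le> 2 * (u x - v x)" for x
    proof -
      have "(\<Sum>i\<in>UNIV. h i x - h' i x) = (u x - v x) * ((u x)\<^sup>2 + u x * v x + (v x)\<^sup>2 - 1)"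
        by (simp add: sum_subtractf u v power2_eq_square power3_eq_cube algebra_simps)
      also have "\<dots> \<le> (u x - v x) * 2"
      proof (intro mult_left_mono)
        have "(u x)\<^sup>2 \<le> 1" "(v x)\<^sup>2 \<le> 1" using u(4)[of x] v(4)[of x] by (simp_all add: abs_square_le_1)
        moreover have "\<bar>u x * v x\<bar> \<le> 1" using u(4)[of x] v(4)[of x] by (simp add: abs_mult mult_le_one)
        ultimately show "(u x)\<^sup>2 + u x * v x + (v x)\<^sup>2 - 1 \<le> 2" by linarith
      qed (use le in simp)
      finally show ?thesis by simp
    qed
  qed
  then show ?thesis by simp
qed

subsection \<open>The bent barrier\<close>

text \<open>\<open>tilt\<close> is the function \<open>\<theta>\<close> above; the term \<open>- 1 / \<surd>q\<close> makes it superharmonic for large \<open>q\<close>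
  also in two variables. The offset \<open>100\<close> in \<open>cyl\<close> makes \<open>\<Delta> (1/q\<^sup>2) \<le> 24/100 / q\<^sup>2\<close>.\<close>

definition cyl :: "'n::finite \<Rightarrow> real ^ 'n \<Rightarrow> real" where
  "cyl m x = 100 + (\<Sum>j\<in>UNIV. (if j = m then 0 else 1) * (x $ j - 0 $ j)\<^sup>2)"

definition tilt :: "real \<Rightarrow> real \<Rightarrow> real" where
  "tilt \<epsilon> q = 1 + \<epsilon> * (3 + ln q - 1 / sqrt q)"

text \<open>\<open>exp (- sqrt 2 w)\<close> for the bent argument \<open>w\<close> is
  \<open>exp (- sqrt 2 (b - x $ m))\<close> times the tilt. As \<open>1 - H t\<close> decays like
  \<open>2 exp (- sqrt 2 t)\<close>, the logarithm makes the tilt enter the tail of the profile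
  linearly.\<close>

definition bent :: "'n::finite \<Rightarrow> real \<Rightarrow> real \<Rightarrow> real ^ 'n \<Rightarrow> real" where
  "bent m \<epsilon> b x = b - x $ m - ln (tilt \<epsilon> (cyl m x)) / sqrt 2"

definition barrier :: "'n::finite \<Rightarrow> real \<Rightarrow> real \<Rightarrow> real ^ 'n \<Rightarrow> real" where
  "barrier m \<epsilon> b x = H (bent m \<epsilon> b x) - 400 * \<epsilon> / (cyl m x)\<^sup>2"

lemma cyl_ge: "100 \<le> cyl m x"
  unfolding cyl_def by (simp add: sum_nonneg)

lemma cyl_norm: "cyl m x = 100 + (norm x)\<^sup>2 - (x $ m)\<^sup>2"
proof -
  have "(\<Sum>j\<in>UNIV. (if j = m then 0 else 1) * (x $ j - 0 $ j)\<^sup>2)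
      = (\<Sum>j\<in>UNIV. (x $ j)\<^sup>2 - (if j = m then (x $ j)\<^sup>2 else 0))"
    by (intro sum.cong) auto
  then show ?thesis by (simp add: cyl_def norm_power2_vec sum_subtractf)
qed

lemma cyl_norm_le:
  assumes "cyl m x \<le> Q" "\<bar>x $ m\<bar> \<le> B"
  shows "norm x \<le> sqrt (Q + B\<^sup>2)"
proof (rule real_le_rsqrt)
  have "(x $ m)\<^sup>2 \<le> B\<^sup>2" using assms(2) power_mono[of "\<bar>x $ m\<bar>" B 2] by simp
  then show "(norm x)\<^sup>2 \<le> Q + B\<^sup>2" using assms(1) by (simp add: cyl_norm)
qed

lemma continuous_on_cyl [continuous_intros]:
  "continuous_on A f \<Longrightarrow> continuous_on A (\<lambda>z. cyl m (f z))"
  unfolding cyl_norm by (intro continuous_intros)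

lemma tilt_bounds:
  assumes "100 \<le> q" "0 < \<epsilon>"
  shows "1 + \<epsilon> * ln q \<le> tilt \<epsilon> q" "tilt \<epsilon> q \<le> 1 + \<epsilon> * (3 + ln q)" "1 \<le> tilt \<epsilon> q"
proof -
  have "1 / sqrt q \<le> 1" "0 \<le> 1 / sqrt q" using assms by simp_all
  then have "0 \<le> 1 / sqrt q" "1 / sqrt q \<le> 3" by linarith+
  then have "\<epsilon> * ln q \<le> \<epsilon> * (3 + ln q - 1 / sqrt q)"
    "\<epsilon> * (3 + ln q - 1 / sqrt q) \<le> \<epsilon> * (3 + ln q)"
    using assms by (auto intro!: mult_left_mono)
  then show "1 + \<epsilon> * ln q \<le> tilt \<epsilon> q" "tilt \<epsilon> q \<le> 1 + \<epsilon> * (3 + ln q)" by (auto simp: tilt_def)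
  moreover have "0 \<le> \<epsilon> * ln q" using assms by simp
  ultimately show "1 \<le> tilt \<epsilon> q" by linarith
qed

lemma DERIV_tilt:
  assumes "0 < q"
  shows "(tilt \<epsilon> has_real_derivative \<epsilon> * (1 / q + 1 / (2 * q * sqrt q))) (at q)"
    and "((\<lambda>q. \<epsilon> * (1 / q + 1 / (2 * q * sqrt q))) has_real_derivative
           \<epsilon> * (- 1 / q\<^sup>2 - 3 / (4 * q\<^sup>2 * sqrt q))) (at q)"
proof -
  define r where "r = sqrt q"
  have r: "r > 0" "q = r * r" "sqrt q = r" using assms by (simp_all add: r_def)
  have n: "q \<noteq> 0" "sqrt q \<noteq> 0" "2 * q * sqrt q \<noteq> 0" using assms by auto
  have D: "(sqrt has_real_derivative inverse r / 2) (at q)"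
    using DERIV_real_sqrt[OF assms] by (simp add: r(3))
  show "(tilt \<epsilon> has_real_derivative \<epsilon> * (1 / q + 1 / (2 * q * sqrt q))) (at q)"
    unfolding tilt_def[abs_def]
    using r(1) by - ((rule derivative_eq_intros D refl assms n)+, simp add: r(3), simp add: r(2) divide_simps)
  show "((\<lambda>q. \<epsilon> * (1 / q + 1 / (2 * q * sqrt q))) has_real_derivative
           \<epsilon> * (- 1 / q\<^sup>2 - 3 / (4 * q\<^sup>2 * sqrt q))) (at q)"
    using r(1) by - ((rule derivative_eq_intros D refl assms n)+, simp add: r(3),
        simp add: r(2) power2_eq_square divide_simps)
qed

text \<open>For \<open>w = b - x\<^sub>m - ln \<theta> / \<surd>2\<close> with \<open>\<theta>\<close> independent of \<open>x\<^sub>m\<close>, the subsolution condition for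
  \<open>H \<circ> w\<close> follows from superharmonicity of \<open>\<theta>\<close>.\<close>
lemma barrier_laplacian:
  fixes m :: "'n::finite"
  assumes card: "CARD('n) \<le> 3" and \<epsilon>: "0 < \<epsilon>"
  shows "\<exists>g h. second_partials (barrier m \<epsilon> b) g h \<and>
    (\<forall>x. let q = cyl m x; w = bent m \<epsilon> b x; \<tau> = 400 * \<epsilon> / q\<^sup>2 in
       H1 w * (\<epsilon> / (sqrt 2 * tilt \<epsilon> q) * (1 / (q * sqrt q) - 700 / q\<^sup>2))
         + \<tau> * (3 * (H w)\<^sup>2 - 124/100 - 3 * H w * \<tau> + \<tau>\<^sup>2)
       \<le> (\<Sum>i\<in>UNIV. h i x) + (barrier m \<epsilon> b x - barrier m \<epsilon> b x ^ 3))"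
proof -
  let ?q = "cyl m"
  let ?c = "\<lambda>i. if i = m then 0 else 1 :: real"
  define gq :: "'n \<Rightarrow> real ^ 'n \<Rightarrow> real" where "gq = (\<lambda>i x. 0 + 2 * ?c i * (x $ i - 0 $ i))"
  define hq :: "'n \<Rightarrow> real ^ 'n \<Rightarrow> real" where "hq = (\<lambda>i x. 0 + 2 * ?c i)"
  have spq: "second_partials ?q gq hq"
    unfolding cyl_def gq_def hq_def
    by (intro second_partials_add second_partials_const second_partials_quadratic)
  have q0: "?q x > 0" for x using cyl_ge[of m x] by linarith
  have Gq: "(\<Sum>i\<in>UNIV. (gq i x)\<^sup>2) = 4 * (?q x - 100)" for x
    unfolding cyl_def gq_def by (simp add: sum_distrib_left power_mult_distrib if_distrib cong: if_cong)
      (intro sum.cong, auto)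
  \<comment> \<open>Each of the at most two transverse variables contributes 2. Since
    \<open>A1 <= 0\<close>, the value 4 is the worst case below.\<close>
  have Lq: "0 \<le> (\<Sum>i\<in>UNIV. hq i x)" "(\<Sum>i\<in>UNIV. hq i x) \<le> 4" for x
  proof -
    have "(\<Sum>i\<in>UNIV. hq i x) = (\<Sum>i\<in>UNIV. 2 - (if i = m then 2 else 0))"
      unfolding hq_def by (intro sum.cong) auto
    also have "\<dots> = 2 * real CARD('n) - 2" by (simp add: sum_subtractf)
    finally show "(\<Sum>i\<in>UNIV. hq i x) \<le> 4" using card by simp
    show "0 \<le> (\<Sum>i\<in>UNIV. hq i x)" unfolding hq_def by (intro sum_nonneg) auto
  qed
  let ?t = "tilt \<epsilon>"
  define t1 where "t1 = (\<lambda>q. \<epsilon> * (1 / q + 1 / (2 * q * sqrt q)))"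
  define t2 where "t2 = (\<lambda>q. \<epsilon> * (- 1 / q\<^sup>2 - 3 / (4 * q\<^sup>2 * sqrt q)))"
  have t: "1 \<le> ?t (?q x)" for x using tilt_bounds(3)[OF cyl_ge \<epsilon>] .
  define A1 where "A1 = (\<lambda>q. - (t1 q / ?t q / sqrt 2))"
  define A2 where "A2 = (\<lambda>q. - ((t2 q * ?t q - t1 q * t1 q) / (?t q * ?t q) / sqrt 2))"
  define gA where "gA = (\<lambda>i x. A1 (?q x) * gq i x)"
  define hA where "hA = (\<lambda>i x. A2 (?q x) * (gq i x)\<^sup>2 + A1 (?q x) * hq i x)"
  have "((\<lambda>q. - (ln (?t q) / sqrt 2)) has_real_derivative A1 (?q x)) (at (?q x))"
    and "(A1 has_real_derivative A2 (?q x)) (at (?q x))" for x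
  proof -
    have T: "(?t has_real_derivative t1 (?q x)) (at (?q x))"
      "(t1 has_real_derivative t2 (?q x)) (at (?q x))"
      unfolding t1_def t2_def by (rule DERIV_tilt[OF q0])+
    have "((\<lambda>q. ln (?t q)) has_real_derivative 1 / ?t (?q x) * t1 (?q x)) (at (?q x))"
      using t[of x] by (intro DERIV_chain2[OF DERIV_ln_divide T(1)]) linarith
    then show "((\<lambda>q. - (ln (?t q) / sqrt 2)) has_real_derivative A1 (?q x)) (at (?q x))"
      unfolding A1_def by (intro DERIV_minus DERIV_cdivide) simp
    show "(A1 has_real_derivative A2 (?q x)) (at (?q x))"
      unfolding A1_def A2_def using t[of x] by (intro DERIV_minus DERIV_cdivide DERIV_divide T) linarith
  qed
  then have spA: "second_partials (\<lambda>x. - (ln (?t (?q x)) / sqrt 2)) gA hA"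
    unfolding gA_def hA_def by (intro second_partials_compose[OF spq])
  let ?w = "bent m \<epsilon> b"
  define gw where "gw = (\<lambda>i x. (0 - (if i = m then 1 else 0)) + gA i x)"
  define hw where "hw = (\<lambda>i x. (0 - 0) + hA i x)"
  have "second_partials (\<lambda>x. (b - x $ m) + - (ln (?t (?q x)) / sqrt 2)) gw hw"
    unfolding gw_def hw_def
    by (intro second_partials_add second_partials_diff second_partials_const second_partials_nth spA)
  then have spw: "second_partials ?w gw hw" by (simp add: bent_def[abs_def])
  define hH where "hH = (\<lambda>i x. - (sqrt 2 * H (?w x) * H1 (?w x)) * (gw i x)\<^sup>2 + H1 (?w x) * hw i x)"
  have spH: "second_partials (\<lambda>x. H (?w x)) (\<lambda>i x. H1 (?w x) * gw i x) hH"
    unfolding hH_def by (rule second_partials_H[OF spw])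
  define g\<tau> where "g\<tau> = (\<lambda>i x. - (800 * \<epsilon> / ?q x ^ 3) * gq i x)"
  define h\<tau> where "h\<tau> = (\<lambda>i x. (2400 * \<epsilon> / ?q x ^ 4) * (gq i x)\<^sup>2 + - (800 * \<epsilon> / ?q x ^ 3) * hq i x)"
  have "((\<lambda>q. 400 * \<epsilon> / q\<^sup>2) has_real_derivative - (800 * \<epsilon> / q ^ 3)) (at q)"
    and "((\<lambda>q. - (800 * \<epsilon> / q ^ 3)) has_real_derivative (2400 * \<epsilon> / q ^ 4)) (at q)" if "q > 0" for q
    using that by (auto intro!: derivative_eq_intros simp: field_simps power2_eq_square power3_eq_cube power4_eq_xxxx)
  then have sp\<tau>: "second_partials (\<lambda>x. 400 * \<epsilon> / (?q x)\<^sup>2) g\<tau> h\<tau>"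
    unfolding g\<tau>_def h\<tau>_def using q0 by (intro second_partials_compose[OF spq]) auto
  have spv: "second_partials (barrier m \<epsilon> b) (\<lambda>i x. H1 (?w x) * gw i x - g\<tau> i x) (\<lambda>i x. hH i x - h\<tau> i x)"
    unfolding barrier_def[abs_def] by (rule second_partials_diff[OF spH sp\<tau>])
  have "let q = cyl m x; w = bent m \<epsilon> b x; \<tau> = 400 * \<epsilon> / q\<^sup>2 in
       H1 w * (\<epsilon> / (sqrt 2 * tilt \<epsilon> q) * (1 / (q * sqrt q) - 700 / q\<^sup>2))
         + \<tau> * (3 * (H w)\<^sup>2 - 124/100 - 3 * H w * \<tau> + \<tau>\<^sup>2)
       \<le> (\<Sum>i\<in>UNIV. hH i x - h\<tau> i x) + (barrier m \<epsilon> b x - barrier m \<epsilon> b x ^ 3)" for x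
  proof -
    define q where "q = ?q x"
    define w where "w = ?w x"
    define \<tau> where "\<tau> = 400 * \<epsilon> / q\<^sup>2"
    define T where "T = ?t q"
    define k where "k = (\<Sum>i\<in>UNIV. hq i x)"
    have q: "100 \<le> q" using cyl_ge by (simp add: q_def)
    have T: "1 \<le> T" using t by (simp add: T_def q_def)
    have k: "0 \<le> k" "k \<le> 4" using Lq by (simp_all add: k_def)
    have \<tau>: "\<tau> > 0" using \<epsilon> q by (simp add: \<tau>_def)
    have t1: "t1 q \<ge> 0" using \<epsilon> q by (simp add: t1_def)
    have "(\<Sum>i\<in>UNIV. (gw i x)\<^sup>2) = (\<Sum>i\<in>UNIV. (if i = m then 1 else 0) + (A1 q)\<^sup>2 * (gq i x)\<^sup>2)"
      by (intro sum.cong refl) (auto simp: gw_def gA_def q_def gq_def power_mult_distrib)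
    also have "\<dots> = 1 + (A1 q)\<^sup>2 * (4 * (q - 100))"
      using Gq[of x] by (simp add: sum.distrib q_def flip: sum_distrib_left)
    finally have Gw: "(\<Sum>i\<in>UNIV. (gw i x)\<^sup>2) - 1 = (A1 q)\<^sup>2 * (4 * (q - 100))" by simp
    have Lw: "(\<Sum>i\<in>UNIV. hw i x) = A2 q * (4 * (q - 100)) + A1 q * k"
      using Gq[of x] by (simp add: hw_def hA_def sum.distrib q_def k_def flip: sum_distrib_left)
    \<comment> \<open>The logarithm cancels the quadratic gradient term up to the factor
      \<open>1 - H w\<close>, whose sign is favourable.\<close>
    have A: "A2 q - sqrt 2 * H w * (A1 q)\<^sup>2 = - t2 q / (sqrt 2 * T) + (1 - H w) * (t1 q)\<^sup>2 / (sqrt 2 * T\<^sup>2)"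
      unfolding A1_def A2_def T_def[symmetric] using T
      by (simp add: power2_eq_square field_simps)
    have "- t2 q / (sqrt 2 * T) \<le> A2 q - sqrt 2 * H w * (A1 q)\<^sup>2"
      unfolding A using H_less_1[of w] T by simp
    then have "- t2 q / (sqrt 2 * T) * (4 * (q - 100)) \<le> (A2 q - sqrt 2 * H w * (A1 q)\<^sup>2) * (4 * (q - 100))"
      using q by (intro mult_right_mono) auto
    moreover have "A1 q * 4 \<le> A1 q * k"
      using k t1 T by (intro mult_left_mono_neg) (auto simp: A1_def T_def[symmetric])
    ultimately have "- t2 q / (sqrt 2 * T) * (4 * (q - 100)) + A1 q * 4
        \<le> (\<Sum>i\<in>UNIV. hw i x) - sqrt 2 * H w * ((\<Sum>i\<in>UNIV. (gw i x)\<^sup>2) - 1)"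
      unfolding Gw Lw by (simp add: algebra_simps)
    moreover have "- t2 q / (sqrt 2 * T) * (4 * (q - 100)) + A1 q * 4
        = 1 / (sqrt 2 * T) * (- t2 q * (4 * (q - 100)) - 4 * t1 q)"
      unfolding A1_def T_def[symmetric] using T by (simp add: field_simps)
    \<comment> \<open>The good term \<open>1 / (q sqrt q)\<close> stems from
      \<open>- 1 / sqrt q\<close>. The offset 100 costs \<open>400 / q^2\<close> through
      \<open>ln q\<close> and \<open>300 / (q^2 sqrt q)\<close> through \<open>- 1 / sqrt q\<close>;
      together at most \<open>700 / q^2\<close>.\<close>
    moreover have "\<epsilon> * (1 / (q * sqrt q) - 700 / q\<^sup>2) \<le> - t2 q * (4 * (q - 100)) - 4 * t1 q"
    proof -
      define r where "r = sqrt q"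
      have r: "q = r\<^sup>2" "sqrt q = r" using q by (simp_all add: r_def)
      have r1: "1 \<le> r" using q by (simp add: r_def)
      have "- t2 q * (4 * (q - 100)) - 4 * t1 q = \<epsilon> * (1 / (r\<^sup>2 * r) - 400 / r ^ 4 - 300 / (r ^ 4 * r))"
        unfolding t1_def t2_def r(2) unfolding r(1) using r1
        by (simp add: field_simps eval_nat_numeral)
      moreover have "300 / (r ^ 4 * r) \<le> 300 / r ^ 4"
        using r1 by (intro divide_left_mono) (auto simp: mult_le_cancel_left1)
      ultimately show ?thesis unfolding r(2) unfolding r(1) using \<epsilon>
        by (auto intro!: mult_left_mono simp flip: power_mult)
    qed
    then have "1 / (sqrt 2 * T) * (\<epsilon> * (1 / (q * sqrt q) - 700 / q\<^sup>2))
        \<le> 1 / (sqrt 2 * T) * (- t2 q * (4 * (q - 100)) - 4 * t1 q)"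
      using T by (intro mult_left_mono) auto
    ultimately have D: "\<epsilon> / (sqrt 2 * T) * (1 / (q * sqrt q) - 700 / q\<^sup>2)
        \<le> (\<Sum>i\<in>UNIV. hw i x) - sqrt 2 * H w * ((\<Sum>i\<in>UNIV. (gw i x)\<^sup>2) - 1)" by simp
    have "H1 w * (\<epsilon> / (sqrt 2 * T) * (1 / (q * sqrt q) - 700 / q\<^sup>2))
        \<le> H1 w * ((\<Sum>i\<in>UNIV. hw i x) - sqrt 2 * H w * ((\<Sum>i\<in>UNIV. (gw i x)\<^sup>2) - 1))"
      using D H1_pos[of w] by (intro mult_left_mono) auto
    then have LH: "H1 w * (\<epsilon> / (sqrt 2 * T) * (1 / (q * sqrt q) - 700 / q\<^sup>2))
        \<le> (\<Sum>i\<in>UNIV. hH i x) + (H w - H w ^ 3)"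
      using second_partials_H_laplacian[where w = ?w and g = gw and h = hw and x = x]
      unfolding hH_def w_def by simp
    have "(\<Sum>i\<in>UNIV. h\<tau> i x) = 2400 * \<epsilon> / q ^ 4 * (4 * (q - 100)) - 800 * \<epsilon> / q ^ 3 * k"
      unfolding h\<tau>_def sum.distrib k_def Gq[of x, symmetric] q_def by (simp add: sum_distrib_left sum_negf)
    also have "\<dots> \<le> 2400 * \<epsilon> / q ^ 4 * (4 * q)"
    proof -
      have "2400 * \<epsilon> / q ^ 4 * (4 * (q - 100)) \<le> 2400 * \<epsilon> / q ^ 4 * (4 * q)"
        using \<epsilon> q by (intro mult_left_mono) auto
      moreover have "0 \<le> 800 * \<epsilon> / q ^ 3 * k" using \<epsilon> q k by simp
      ultimately show ?thesis by linarith
    qed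
    also have "\<dots> = 24 * \<tau> / q" using q by (simp add: \<tau>_def field_simps eval_nat_numeral)
    also have "\<dots> \<le> 24 * \<tau> / 100" using q \<tau> by (intro divide_left_mono) auto
    finally have L\<tau>: "(\<Sum>i\<in>UNIV. h\<tau> i x) \<le> 24/100 * \<tau>" by simp
    have v: "barrier m \<epsilon> b x = H w - \<tau>" by (simp add: barrier_def w_def \<tau>_def q_def)
    have "(H w - \<tau>) - (H w - \<tau>) ^ 3 = (H w - H w ^ 3) + \<tau> * (3 * (H w)\<^sup>2 - 1 - 3 * H w * \<tau> + \<tau>\<^sup>2)"
      by (simp add: power2_eq_square power3_eq_cube algebra_simps)
    moreover have "\<tau> * (3 * (H w)\<^sup>2 - 124/100 - 3 * H w * \<tau> + \<tau>\<^sup>2)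
        = \<tau> * (3 * (H w)\<^sup>2 - 1 - 3 * H w * \<tau> + \<tau>\<^sup>2) - 24/100 * \<tau>" by (simp add: algebra_simps)
    ultimately have "H1 w * (\<epsilon> / (sqrt 2 * T) * (1 / (q * sqrt q) - 700 / q\<^sup>2))
         + \<tau> * (3 * (H w)\<^sup>2 - 124/100 - 3 * H w * \<tau> + \<tau>\<^sup>2)
       \<le> (\<Sum>i\<in>UNIV. hH i x - h\<tau> i x) + (barrier m \<epsilon> b x - barrier m \<epsilon> b x ^ 3)"
      unfolding v sum_subtractf using LH L\<tau> by linarith
    then show ?thesis by (simp only: Let_def T_def \<tau>_def w_def q_def)
  qed
  then show ?thesis using spv by blast
qed

text \<open>With \<open>r\<close> the fourth root of \<open>q\<close>, the bound
  \<open>ln r <= r - 1\<close> reduces the claim to \<open>48000 r <= r^2 - 700\<close>.\<close>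

lemma log_growth:
  obtains Q :: real where "100 \<le> Q" "\<And>q. Q \<le> q \<Longrightarrow> 12000 * (4 + ln q) \<le> sqrt q - 700"
proof -
  have "12000 * (4 + ln q) \<le> sqrt q - 700" if q: "60000 ^ 4 \<le> q" for q :: real
  proof -
    define r where "r = sqrt (sqrt q)"
    have q0: "q > 0" using q by (rule less_le_trans[rotated]) simp
    have "r ^ 4 = (r\<^sup>2)\<^sup>2" by (simp flip: power_mult)
    then have r: "r > 0" "sqrt q = r\<^sup>2" "q = r ^ 4" using q0 by (simp_all add: r_def)
    have "60000 \<le> r"
    proof (rule ccontr)
      assume "\<not> 60000 \<le> r"
      then have "r ^ 4 < 60000 ^ 4" using r(1) by (intro power_strict_mono) auto
      then show False using q r(3) by linarith
    qed
    define s where "s = r\<^sup>2"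
    have "60000 * r \<le> s"
      unfolding s_def power2_eq_square using \<open>60000 \<le> r\<close> r(1) by (intro mult_right_mono) auto
    moreover have "ln q = 4 * ln r" unfolding r(3) using r(1) by (simp add: ln_realpow)
    moreover have "ln r \<le> r - 1" using r(1) by (intro ln_le_minus_one)
    ultimately show ?thesis using \<open>60000 \<le> r\<close> unfolding r(2) s_def[symmetric] by argo
  qed
  moreover have "(100::real) \<le> 60000 ^ 4" by simp
  ultimately show ?thesis by (rule that[rotated])
qed

text \<open>The correction \<open>\<tau>\<close> repairs the subsolution property near the axis where \<open>H\<close> is close to
  \<open>\<plusminus>1\<close>; far from the axis it is dominated by the superharmonicity of the tilt.\<close>
lemma barrier_excess_pos:
  fixes Hw \<epsilon> q :: real
  assumes \<epsilon>: "0 < \<epsilon>" "\<epsilon> \<le> 1" and q: "100 \<le> q" and Hw: "\<bar>Hw\<bar> < 1"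
    and alt: "95/100 \<le> \<bar>Hw\<bar> \<or> 12000 * (4 + ln q) \<le> sqrt q - 700"
  defines "\<tau> \<equiv> 400 * \<epsilon> / q\<^sup>2"
  shows "0 < (1 - Hw\<^sup>2) / sqrt 2 * (\<epsilon> / (sqrt 2 * tilt \<epsilon> q) * (1 / (q * sqrt q) - 700 / q\<^sup>2))
         + \<tau> * (3 * Hw\<^sup>2 - 124/100 - 3 * Hw * \<tau> + \<tau>\<^sup>2)"
proof -
  let ?T = "tilt \<epsilon> q"
  define y where "y = \<epsilon> / q\<^sup>2"
  define z where "z = (1 - Hw\<^sup>2) / 2"
  have y: "y > 0" using \<epsilon> q by (simp add: y_def)
  have \<tau>y: "\<tau> = 400 * y" by (simp add: \<tau>_def y_def)
  have T: "1 \<le> ?T" using tilt_bounds(3) q \<epsilon> by blast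
  have z: "0 \<le> z" "z \<le> 1/2" using Hw by (simp_all add: z_def abs_square_le_1)
  have "q * q \<ge> 100 * 100" using q by (intro mult_mono) auto
  then have "\<tau> \<le> 4/100" using \<epsilon> by (simp add: \<tau>_def power2_eq_square divide_le_eq)
  then have "\<bar>Hw * \<tau>\<bar> \<le> 1 * (4/100)"
    unfolding abs_mult using Hw y \<tau>y by (intro mult_mono) auto
  then have low: "- 12/100 \<le> - 3 * Hw * \<tau> + \<tau>\<^sup>2" using zero_le_power2[of \<tau>] by linarith
  have eq: "(1 - Hw\<^sup>2) / sqrt 2 * (\<epsilon> / (sqrt 2 * ?T) * (1 / (q * sqrt q) - 700 / q\<^sup>2))
      = y * (z * ((sqrt q - 700) / ?T))"
  proof -
    define r where "r = sqrt q"
    have r: "q = r\<^sup>2" "sqrt q = r" "r > 0" using q by (simp_all add: r_def)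
    have *: "x1 / sqrt 2 * (x2 / (sqrt 2 * ?T) * x3) = x2 * (x1 / 2 * (x3 / ?T))" for x1 x2 x3
      by (simp add: field_simps)
    have "1 / (q * sqrt q) - 700 / q\<^sup>2 = (sqrt q - 700) / q\<^sup>2"
      unfolding r(2) unfolding r(1) using r(3) by (simp add: field_simps eval_nat_numeral)
    then show ?thesis unfolding * y_def z_def by simp
  qed
  \<comment> \<open>Both contributions are divided by \<open>\<epsilon> / q^2\<close>, and 136/100
    is 124/100 plus the 12/100 lost in \<open>low\<close>. For \<open>|Hw| >= 95/100\<close> the
    correction gives at least 539 against a loss of at most 350. Otherwise
    \<open>z >= 48/1000\<close>, and \<open>12000 z >= 576\<close> exceeds
    \<open>400 136/100 = 544\<close>.\<close>
  have "0 < z * ((sqrt q - 700) / ?T) + 400 * (3 * Hw\<^sup>2 - 136/100)"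
    using alt
  proof
    assume H: "95/100 \<le> \<bar>Hw\<bar>"
    then have "(95/100)\<^sup>2 \<le> \<bar>Hw\<bar>\<^sup>2" by (intro power_mono) auto
    then have "9025/10000 \<le> Hw\<^sup>2" by (simp add: power2_eq_square)
    moreover have "- 700 \<le> (sqrt q - 700) / ?T"
      using T q by (simp add: le_divide_eq) (smt (verit) real_sqrt_ge_zero)
    then have "z * (- 700) \<le> z * ((sqrt q - 700) / ?T)" using z by (intro mult_left_mono)
    ultimately show ?thesis using z by simp
  next
    assume far: "12000 * (4 + ln q) \<le> sqrt q - 700"
    show ?thesis
    proof (cases "95/100 \<le> \<bar>Hw\<bar>")
      case True
      then have "(95/100)\<^sup>2 \<le> \<bar>Hw\<bar>\<^sup>2" by (intro power_mono) auto
      then have "9025/10000 \<le> Hw\<^sup>2" by (simp add: power2_eq_square)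
      moreover have "0 \<le> sqrt q - 700" using far ln_ge_zero[OF order_trans[OF _ q]] by simp
      then have "0 \<le> (sqrt q - 700) / ?T" using T by (intro divide_nonneg_nonneg) linarith+
      then have "0 \<le> z * ((sqrt q - 700) / ?T)" using z(1) by (intro mult_nonneg_nonneg)
      ultimately show ?thesis by simp
    next
      case False
      then have "\<bar>Hw\<bar>\<^sup>2 \<le> (95/100)\<^sup>2" by (intro power_mono) auto
      then have z': "48/1000 \<le> z" by (simp add: z_def power2_eq_square)
      have "?T \<le> 1 + \<epsilon> * (3 + ln q)" using tilt_bounds(2) q \<epsilon> by blast
      also have "\<epsilon> * (3 + ln q) \<le> 1 * (3 + ln q)" using \<epsilon> q by (intro mult_right_mono) auto
      finally have "?T \<le> 1 + (3 + ln q)" by simp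
      then have "12000 * ?T \<le> 12000 * (4 + ln q)" by simp
      then have "12000 * ?T \<le> sqrt q - 700" using far by (rule order_trans)
      then have "12000 \<le> (sqrt q - 700) / ?T" using T by (simp add: le_divide_eq)
      then have "(48/1000) * 12000 \<le> z * ((sqrt q - 700) / ?T)" using z' by (intro mult_mono) auto
      then show ?thesis using zero_le_power2[of Hw] by argo
    qed
  qed
  then have "0 < y * (z * ((sqrt q - 700) / ?T) + 400 * (3 * Hw\<^sup>2 - 136/100))" using y by simp
  also have "\<dots> = y * (z * ((sqrt q - 700) / ?T)) + \<tau> * (3 * Hw\<^sup>2 - 136/100)"
    by (simp add: \<tau>y algebra_simps)
  also have "\<dots> \<le> y * (z * ((sqrt q - 700) / ?T)) + \<tau> * (3 * Hw\<^sup>2 - 124/100 - 3 * Hw * \<tau> + \<tau>\<^sup>2)"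
    using low y \<tau>y by (intro add_left_mono mult_left_mono) auto
  finally show ?thesis unfolding eq .
qed

section \<open>Raising a profile by means of the barrier\<close>

lemma barrier_bounds:
  assumes "0 < \<epsilon>"
  shows "barrier m \<epsilon> b x < H (bent m \<epsilon> b x)" and "bent m \<epsilon> b x \<le> b - x $ m"
proof -
  have "cyl m x \<noteq> 0" using cyl_ge[of m x] by linarith
  then show "barrier m \<epsilon> b x < H (bent m \<epsilon> b x)" using assms by (simp add: barrier_def)
  show "bent m \<epsilon> b x \<le> b - x $ m"
    using tilt_bounds(3)[OF cyl_ge[of m x] assms] by (simp add: bent_def)
qed

lemma continuous_on_barrier:
  assumes "0 < \<epsilon>" "continuous_on A f" "continuous_on A b"
  shows "continuous_on A (\<lambda>z. barrier m \<epsilon> (b z) (f z))"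
proof -
  have c: "cyl m x > 0" for x using cyl_ge[of m x] by linarith
  have n: "sqrt (cyl m x) \<noteq> 0" "cyl m x \<noteq> 0" for x using c[of x] by auto
  have t: "1 + \<epsilon> * (3 + ln (cyl m x) - 1 / sqrt (cyl m x)) > 0" for x
    using tilt_bounds(3)[OF cyl_ge[of m x] assms(1)] by (simp add: tilt_def)
  show ?thesis
    unfolding barrier_def bent_def tilt_def
    by (intro continuous_intros assms) (use n t c in \<open>auto simp: less_imp_neq[OF t, symmetric]\<close>)
qed

lemma barrier_tendsto:
  "((\<lambda>\<epsilon>. barrier m \<epsilon> b x) \<longlongrightarrow> H (b - x $ m)) (at_right 0)"
proof -
  have "((\<lambda>\<epsilon>. barrier m \<epsilon> b x) \<longlongrightarrow> H (b - x $ m - ln (1 + 0 * (3 + ln (cyl m x) - 1 / sqrt (cyl m x))) / sqrt 2)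
      - 400 * 0 / (cyl m x)\<^sup>2) (at_right 0)"
    unfolding barrier_def bent_def tilt_def
    by (intro tendsto_intros tendsto_compose[OF isCont_def[THEN iffD1, OF DERIV_isCont[OF DERIV_H]]])
       (use cyl_ge[of m x] in auto)
  then show ?thesis by simp
qed

text \<open>Since \<open>s - s\<^sup>3\<close> decreases near \<open>\<plusminus>1\<close>, \<open>barrier - u\<close> has no positive maximum where
  \<open>H\<close> is close to \<open>\<plusminus>1\<close>, so a first contact, as the barrier is raised, would happen in a compact set; there
  the barrier is a strict subsolution or already below \<open>u\<close>. Letting \<open>\<epsilon> \<rightarrow> 0\<close> flattens the barrier.\<close>
lemma lift_profile:
  fixes u :: "real ^ 'n::finite \<Rightarrow> real"
  assumes sp: "second_partials u g h" and cont: "continuous_on UNIV u"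
    and pde: "\<And>x. (\<Sum>i\<in>UNIV. h i x) = u x ^ 3 - u x"
    and low: "\<And>x. -1 \<le> u x" and card: "CARD('n) \<le> 3"
    and above: "\<And>x. H (a - x $ m) < u x"
  obtains \<delta> where "0 < \<delta>" "\<And>x. H (a + \<delta> - x $ m) \<le> u x"
proof -
  obtain Q0 :: real where Q0: "100 \<le> Q0" "\<And>q. Q0 \<le> q \<Longrightarrow> 12000 * (4 + ln q) \<le> sqrt q - 700"
    by (rule log_growth) blast
  obtain M where M: "M > 0" "\<And>t. M \<le> t \<Longrightarrow> 95/100 < H t"
    by (rule H_close_1[of "95/100"]) auto
  have small: "\<bar>t\<bar> < M" if "\<bar>H t\<bar> < 95/100" for t
  proof (rule ccontr)
    assume "\<not> \<bar>t\<bar> < M"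
    then consider "M \<le> t" | "M \<le> - t" by linarith
    then show False using M(2)[of t] M(2)[of "- t"] that by cases (auto simp: H_odd)
  qed
  \<comment> \<open>This radius bounds the transition layer over \<open>cyl m x <= Q\<close>
    uniformly in \<open>\<epsilon>\<close> and \<open>s\<close>. Uniformity is essential: the gap
    \<open>\<mu>\<close>, and with it the lift \<open>\<delta>\<close>, is fixed before
    \<open>\<epsilon>\<close> tends to 0.\<close>
  define \<rho> where "\<rho> = (\<lambda>Q. sqrt (Q + (\<bar>a\<bar> + 1 + M + (3 + ln Q))\<^sup>2))"
  have inside: "norm x \<le> \<rho> Q"
    if "0 < \<epsilon>" "\<epsilon> \<le> 1" "0 \<le> s" "s \<le> 1" "\<bar>H (bent m \<epsilon> (a + s) x)\<bar> < 95/100" "cyl m x \<le> Q" for \<epsilon> s x Q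
  proof -
    let ?q = "cyl m x"
    note q = cyl_ge[of m x]
    note tb = tilt_bounds[OF q \<open>0 < \<epsilon>\<close>]
    have "ln (tilt \<epsilon> ?q) / sqrt 2 \<le> ln (tilt \<epsilon> ?q) / 1"
      using tb(3) by (intro divide_left_mono) auto
    also have "\<dots> \<le> \<epsilon> * (3 + ln ?q)" using ln_le_minus_one[of "tilt \<epsilon> ?q"] tb by simp
    also have "\<dots> \<le> 1 * (3 + ln ?q)" using that(2) q by (intro mult_right_mono) auto
    also have "\<dots> \<le> 3 + ln Q" using that(6) q by simp
    finally have "ln (tilt \<epsilon> ?q) / sqrt 2 \<le> 3 + ln Q" .
    moreover have "0 \<le> ln (tilt \<epsilon> ?q) / sqrt 2" using tb(3) by simp
    moreover have "\<bar>bent m \<epsilon> (a + s) x\<bar> < M" using small that(5) by blast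
    ultimately have "\<bar>x $ m\<bar> \<le> \<bar>a\<bar> + 1 + M + (3 + ln Q)"
      using that(3,4) unfolding bent_def by linarith
    then show ?thesis unfolding \<rho>_def by (rule cyl_norm_le[OF that(6)])
  qed
  obtain \<mu> where \<mu>: "\<mu> > 0" "\<And>x. norm x \<le> \<rho> Q0 \<Longrightarrow> H (a - x $ m) + \<mu> \<le> u x"
  proof -
    let ?f = "\<lambda>x. u x - H (a - x $ m)"
    have "continuous_on (cball 0 (\<rho> Q0)) ?f"
      by (intro continuous_intros continuous_on_subset[OF cont]) auto
    moreover have "cball 0 (\<rho> Q0) \<noteq> ({} :: (real ^ 'n) set)"
    proof -
      have "0 \<le> \<rho> Q0" unfolding \<rho>_def using Q0(1) by (intro real_sqrt_ge_zero add_nonneg_nonneg) auto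
      then show ?thesis by simp
    qed
    ultimately have "\<exists>p\<in>cball 0 (\<rho> Q0). \<forall>x\<in>cball 0 (\<rho> Q0). ?f p \<le> ?f x"
      by (intro continuous_attains_inf compact_cball)
    then obtain p where p: "\<And>x. norm x \<le> \<rho> Q0 \<Longrightarrow> ?f p \<le> ?f x" by (meson mem_cball_0)
    have "?f p > 0" using above[of p] by simp
    moreover have "H (a - x $ m) + ?f p \<le> u x" if "norm x \<le> \<rho> Q0" for x using p[OF that] by linarith
    ultimately show ?thesis by (rule that)
  qed
  \<comment> \<open>\<open>\<delta> <= \<mu>\<close> excludes contact in the layer near the axis.
    The bound 4/100 ensures that where the bent profile is at least 95/100, the original one, and so
    \<open>u\<close>, still exceeds 9/10.\<close>
  define \<delta> where "\<delta> = min \<mu> (4/100)"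
  have \<delta>: "0 < \<delta>" "\<delta> \<le> \<mu>" "\<delta> \<le> 4/100" using \<mu>(1) by (auto simp: \<delta>_def)
  have main: "barrier m \<epsilon> (a + \<delta>) x \<le> u x" if \<epsilon>: "0 < \<epsilon>" "\<epsilon> \<le> 1" for \<epsilon> x
  proof (rule ccontr)
    assume neg: "\<not> barrier m \<epsilon> (a + \<delta>) x \<le> u x"
    define v where "v = (\<lambda>s. barrier m \<epsilon> (a + s))"
    define w where "w = (\<lambda>s. bent m \<epsilon> (a + s))"
    have v_less: "v s x < H (w s x)" and w_le: "w s x \<le> a + s - x $ m" for s x
      unfolding v_def w_def by (rule barrier_bounds[OF \<epsilon>(1)])+
    \<comment> \<open>Strictness of the subsolution rules out a maximum with value exactly 0, and
      coercivity of the cubic confines a positive maximum to the transition layer.\<close>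
    have contact: "u p < v s p \<and> \<bar>H (w s p)\<bar> < 95/100"
      if s: "0 \<le> s" "s \<le> \<delta>" and p: "\<And>x. v s x - u x \<le> v s p - u p" and ge: "u p \<le> v s p" for s p
    proof -
      have Hp: "H (w s p) \<le> H (a - p $ m) + s"
      proof -
        have "H (w s p) \<le> H (a - p $ m + s)" using w_le[of s p] by simp
        then show ?thesis using H_add_le[OF s(1), of "a - p $ m"] by linarith
      qed
      have far: "Q0 \<le> cyl m p" if "\<bar>H (w s p)\<bar> < 95/100"
      proof (rule ccontr)
        assume "\<not> Q0 \<le> cyl m p"
        then have "norm p \<le> \<rho> Q0" using inside[of \<epsilon> s p Q0] \<epsilon> s \<delta> that by (simp add: w_def)
        then have "H (w s p) \<le> u p" using \<mu>(2)[of p] Hp s \<delta> by linarith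
        then show False using v_less[of s p] ge by linarith
      qed
      have H1: "\<bar>H (w s p)\<bar> < 1" using H_less_1[of "w s p"] H_gt_m1[of "w s p"] by linarith
      obtain g' h' where v': "second_partials (v s) g' h'"
        and ex: "H1 (w s p) * (\<epsilon> / (sqrt 2 * tilt \<epsilon> (cyl m p)) * (1 / (cyl m p * sqrt (cyl m p)) - 700 / (cyl m p)\<^sup>2))
         + 400 * \<epsilon> / (cyl m p)\<^sup>2 * (3 * (H (w s p))\<^sup>2 - 124/100
             - 3 * H (w s p) * (400 * \<epsilon> / (cyl m p)\<^sup>2) + (400 * \<epsilon> / (cyl m p)\<^sup>2)\<^sup>2)
         \<le> (\<Sum>i\<in>UNIV. h' i p) + (v s p - v s p ^ 3)"
        using barrier_laplacian[OF card \<epsilon>(1), of m "a + s"] unfolding v_def w_def Let_def by blast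
      have "0 < (\<Sum>i\<in>UNIV. h' i p) + (v s p - v s p ^ 3)"
        by (rule less_le_trans[OF barrier_excess_pos[OF \<epsilon> cyl_ge H1, folded H1_def] ex])
           (use far Q0(2) in force)
      moreover have "(\<Sum>i\<in>UNIV. h' i p) \<le> u p ^ 3 - u p"
        using laplacian_le_at_max[OF sp v' zero_less_one p] by (simp add: pde)
      ultimately have incr: "v s p ^ 3 - v s p < u p ^ 3 - u p" by linarith
      then have lt: "u p < v s p" using ge by (cases "u p = v s p") auto
      moreover have "\<bar>H (w s p)\<bar> < 95/100"
      proof (rule ccontr)
        assume "\<not> \<bar>H (w s p)\<bar> < 95/100"
        then have "9/10 \<le> u p \<or> v s p \<le> - (9/10)"
          using Hp s \<delta> above[of p] v_less[of s p] by linarith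
        then show False using cubic_increment[OF lt] incr lt by linarith
      qed
      ultimately show ?thesis ..
    qed
    \<comment> \<open>Beyond \<open>Q\<close> the tilt is at least \<open>exp 2\<close>, so the
      bending lowers the argument by at least 1, more than the lift \<open>\<delta>\<close>.\<close>
    define Q where "Q = exp (exp 2 / \<epsilon>)"
    have beyond: "v s x \<le> u x" if "s \<le> \<delta>" "Q < cyl m x" for s x
    proof -
      have "ln Q < ln (cyl m x)" using that(2) cyl_ge[of m x] by (intro ln_less_cancel_iff[THEN iffD2]) (auto simp: Q_def)
      then have "exp 2 \<le> \<epsilon> * ln (cyl m x)" using \<epsilon>(1) by (simp add: Q_def field_simps)
      then have "exp 2 \<le> tilt \<epsilon> (cyl m x)" using tilt_bounds(1)[OF cyl_ge[of m x] \<epsilon>(1)] by linarith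
      then have "2 \<le> ln (tilt \<epsilon> (cyl m x))"
        using tilt_bounds(3)[OF cyl_ge[of m x] \<epsilon>(1)] by (simp add: ln_ge_iff)
      then have "2 / 2 \<le> ln (tilt \<epsilon> (cyl m x)) / sqrt 2"
        by (intro frac_le) (auto intro: real_le_lsqrt)
      then have "w s x \<le> a - x $ m" using that(1) \<delta> unfolding w_def bent_def by linarith
      then have "H (w s x) \<le> H (a - x $ m)" by simp
      then show ?thesis using v_less[of s x] above[of x] by linarith
    qed
    define K where "K = cball (0 :: real ^ 'n) (\<rho> Q)"
    have contv: "continuous_on UNIV (v s)" for s
      unfolding v_def by (intro continuous_on_barrier \<epsilon> continuous_intros)
    have contact_in_K: "\<exists>p\<in>K. u p < v s p" if s: "0 \<le> s" "s \<le> \<delta>" and x0: "u x0 < v s x0" for s x0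
    proof -
      \<comment> \<open>The excess at \<open>x0\<close> is not surpassed far away: for very negative
        \<open>x $ m\<close>, \<open>u\<close> is within \<open>e\<close> of 1; for large
        \<open>x $ m\<close>, \<open>v s\<close> is within \<open>e\<close> of -1; for large
        \<open>cyl\<close>, the lift is undone. Hence a global maximum exists.\<close>
      define e where "e = v s x0 - u x0"
      have e: "e > 0" using x0 by (simp add: e_def)
      obtain T where T: "T > 0" "\<And>t. T \<le> t \<Longrightarrow> 1 - e < H t"
        by (rule H_close_1[of "1 - e"]) (use e in auto)
      have out: "v s x - u x \<le> v s x0 - u x0"
        if "norm x0 + sqrt (Q + (\<bar>a\<bar> + 1 + T)\<^sup>2) < dist x0 x" for x
      proof -
        consider "Q < cyl m x" | "T \<le> a - x $ m" | "a + 1 + T \<le> x $ m"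
          | "cyl m x \<le> Q" "\<bar>x $ m\<bar> \<le> \<bar>a\<bar> + 1 + T" using T(1) by linarith
        then show ?thesis
        proof cases
          case 1
          then show ?thesis using beyond[OF s(2), of x] e by (simp add: e_def)
        next
          case 2
          then show ?thesis using T(2)[of "a - x $ m"] above[of x] v_less[of s x] H_less_1[of "w s x"]
            by (simp add: e_def)
        next
          case 3
          then have "w s x \<le> - T" using w_le[of s x] s \<delta> by linarith
          then have "H (w s x) \<le> - H T" by (simp flip: H_odd)
          then show ?thesis using T(2)[of T] low[of x] v_less[of s x] by (simp add: e_def)
        next
          case 4
          then have "norm x \<le> sqrt (Q + (\<bar>a\<bar> + 1 + T)\<^sup>2)" by (rule cyl_norm_le)
          then show ?thesis using that norm_triangle_ineq4[of x0 x] by (simp add: dist_norm)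
        qed
      qed
      have "continuous_on UNIV (\<lambda>x. v s x - u x)" by (intro continuous_intros contv cont)
      from attains_global_max[OF this out] obtain p where p: "\<And>x. v s x - u x \<le> v s p - u p" by blast
      have "u p < v s p" using p[of x0] x0 by linarith
      moreover have "\<bar>H (w s p)\<bar> < 95/100" using contact[OF s p] \<open>u p < v s p\<close> by simp
      moreover have "cyl m p \<le> Q" using beyond[OF s(2), of p] \<open>u p < v s p\<close> by linarith
      ultimately show ?thesis using inside[of \<epsilon> s p Q] \<epsilon> s \<delta> by (auto simp: K_def w_def)
    qed
    obtain q where q: "q \<in> K" "u q < v \<delta> q"
      using contact_in_K[of \<delta> x] \<delta> neg by (auto simp: v_def)
    have joint: "continuous_on ({0..\<delta>} \<times> K) (\<lambda>z. v (fst z) (snd z) - u (snd z))"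
      unfolding v_def
      by (intro continuous_intros continuous_on_barrier \<epsilon> continuous_on_compose2[OF cont]) auto
    have start: "v 0 x - u x < 0" for x
    proof -
      have "H (w 0 x) \<le> H (a - x $ m)" using w_le[of 0 x] by simp
      then show ?thesis using v_less[of 0 x] above[of x] by linarith
    qed
    have "compact K" by (simp add: K_def)
    obtain s p where s: "0 \<le> s" "s \<le> \<delta>" and p: "v s p - u p = 0"
      and below: "\<And>x. x \<in> K \<Longrightarrow> v s x - u x \<le> 0"
      using first_contact[of K \<delta> "\<lambda>s x. v s x - u x" q, OF \<open>compact K\<close> joint start] \<delta>(1) q by auto
    \<comment> \<open>A positive excess anywhere would also occur in \<open>K\<close>, so the
      contact found on \<open>K\<close> is a global maximum with value 0, which
      \<open>contact\<close> forbids.\<close>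
    have "v s x - u x \<le> v s p - u p" for x
      using contact_in_K[OF s, of x] below p by fastforce
    then show False using contact[OF s, of p] p by simp
  qed
  have "H (a + \<delta> - x $ m) \<le> u x" for x
  proof (rule tendsto_upperbound[OF barrier_tendsto])
    show "\<forall>\<^sub>F \<epsilon> in at_right 0. barrier m \<epsilon> (a + \<delta>) x \<le> u x"
      unfolding eventually_at_right_field using main by (intro exI[of _ 1]) auto
  qed simp
  then show ?thesis using that \<delta>(1) by blast
qed

section \<open>The extremal profile and the conclusion\<close>

lemma solution_above_eq_profile:
  fixes u :: "real ^ 'n::finite \<Rightarrow> real"
  assumes sp: "second_partials u g h" and cont: "continuous_on UNIV u"
    and pde: "\<And>x. (\<Sum>i\<in>UNIV. h i x) = u x ^ 3 - u x"
    and card: "CARD('n) \<le> 3" and nonconst: "\<not> u constant_on UNIV"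
    and pos: "\<And>x. x $ m \<le> 0 \<Longrightarrow> u x > 0"
  shows "\<exists>a. \<forall>x. u x = H (a - x $ m)"
proof -
  have le1: "u x \<le> 1" for x by (rule solution_le_1[OF sp cont pde])
  have "- u x \<le> 1" for x
    by (rule solution_le_1[OF second_partials_minus[OF sp]])
       (auto intro!: continuous_intros cont simp: sum_negf pde)
  then have low: "- 1 \<le> u x" for x by (smt (verit))
  obtain T where T: "\<And>x. x $ m \<le> - T \<Longrightarrow> 9/10 \<le> u x"
    by (rule positive_solution_near_1[OF sp cont pde pos card]) blast+
  obtain a0 where a0: "\<And>x. H (a0 - x $ m) \<le> u x"
    by (rule above_some_profile[OF sp cont pde low T]) blast+
  define S where "S = {a. \<forall>x. H (a - x $ m) \<le> u x}"
  have "S \<noteq> {}" using a0 by (auto simp: S_def)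
  moreover have bdd: "bdd_above S"
  proof -
    \<comment> \<open>The constant solution 1 lies above every profile; nonconstancy excludes
      it.\<close>
    obtain x0 where "u x0 \<noteq> 1" using nonconst unfolding constant_on_def by blast
    then have "u x0 < 1" using le1[of x0] by simp
    then obtain M where M: "\<And>t. M \<le> t \<Longrightarrow> u x0 < H t" by (rule H_close_1) blast
    have "a \<le> M + x0 $ m" if "a \<in> S" for a
    proof (rule ccontr)
      assume "\<not> a \<le> M + x0 $ m"
      then have "u x0 < H (a - x0 $ m)" by (intro M) simp
      moreover have "H (a - x0 $ m) \<le> u x0" using that by (simp add: S_def)
      ultimately show False by simp
    qed
    then show ?thesis by (rule bdd_aboveI)
  qed
  moreover have "closed S"
    unfolding S_def by (intro closed_Collect_all closed_Collect_le continuous_intros)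
  ultimately have "Sup S \<in> S" by (intro closed_contains_Sup)
  then have le: "H (Sup S - x $ m) \<le> u x" for x by (simp add: S_def)
  have "\<exists>z. u z = H (Sup S - z $ m)"
  proof (rule ccontr)
    assume "\<nexists>z. u z = H (Sup S - z $ m)"
    then have "H (Sup S - x $ m) < u x" for x using le[of x] by (metis less_eq_real_def)
    then obtain \<delta> where "0 < \<delta>" "\<And>x. H (Sup S + \<delta> - x $ m) \<le> u x"
      by (rule lift_profile[OF sp cont pde low card]) blast+
    then have "Sup S + \<delta> \<in> S" by (simp add: S_def)
    then have "Sup S + \<delta> \<le> Sup S" using bdd by (rule cSup_upper)
    then show False using \<open>0 < \<delta>\<close> by simp
  qed
  then obtain z where z: "u z = H (Sup S - z $ m)" by blast
  obtain g' h' where v: "second_partials (\<lambda>x. H (Sup S - x $ m)) g' h'"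
      "\<And>x. (\<Sum>i\<in>UNIV. h' i x) = H (Sup S - x $ m) ^ 3 - H (Sup S - x $ m)"
    using profile_solution[of "Sup S" m] by blast
  have bu: "\<bar>u x\<bar> \<le> 1" for x using le1[of x] low[of x] by linarith
  have bv: "\<bar>H t\<bar> \<le> 1" for t using H_less_1[of t] H_gt_m1[of t] by linarith
  have "u x = H (Sup S - x $ m)" for x
    by (rule touching_solutions_eq[OF sp cont pde bu v(1) continuous_on_profile v(2) bv le z])
  then show ?thesis by blast
qed

theorem theorem1:
  fixes u :: "real ^ 'n::{finite,linorder} \<Rightarrow> real"
  assumes "CARD('n) \<in> {1, 2, 3}"
    and "classical_solution u"
    and "\<not> u constant_on UNIV"
    and "{x. u x = 0} \<subseteq> {x. last_coord x > 0}"
  shows "\<exists>a. (\<forall>x. u x = H (- last_coord x + a)) \<or> (\<forall>x. u x = H (last_coord x + a))"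
proof -
  define m :: 'n where "m = Max UNIV"
  have card: "CARD('n) \<le> 3" using assms(1) by auto
  have C2: "C2 u" using assms(2) by (simp add: classical_solution_def)
  note sp = second_partials_C2[OF C2]
  have cont: "continuous_on UNIV u" using C2 by (simp add: C2_def C1_def)
  have pde: "(\<Sum>i\<in>UNIV. partial i (partial i u) x) = u x ^ 3 - u x" for x
  proof -
    have "- laplacian u x = u x - u x ^ 3" using assms(2) by (simp add: classical_solution_def)
    then show ?thesis by (simp add: laplacian_def)
  qed
  define D where "D = {x :: (real, 'n) vec. x $ m \<le> 0}"
  have nz: "u x \<noteq> 0" if "x \<in> D" for x
    using assms(4) that by (force simp: last_coord_def D_def m_def)
  have "convex D"
    unfolding D_def using convex_halfspace_le[of "axis m (1::real)" 0] by (simp add: inner_axis')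
  then have "connected (u ` D)"
    using cont by (intro connected_continuous_image convex_connected) (auto intro: continuous_on_subset)
  then have "is_interval (u ` D)" by (simp add: is_interval_connected_1)
  have sign: "(\<forall>x\<in>D. u x > 0) \<or> (\<forall>x\<in>D. u x < 0)"
  proof (rule ccontr)
    assume "\<not> ?thesis"
    then obtain x y where xy: "x \<in> D" "y \<in> D" "u x \<le> 0" "0 \<le> u y" by (meson not_less)
    then have "0 \<in> u ` D"
      using mem_is_interval_1_I[OF \<open>is_interval (u ` D)\<close>, of "u x" "u y" 0] by simp
    then show False using nz by force
  qed
  from sign show ?thesis
  proof
    assume "\<forall>x\<in>D. u x > 0"
    then have "\<exists>a. \<forall>x. u x = H (a - x $ m)"
      by (intro solution_above_eq_profile[OF sp cont pde card assms(3)]) (auto simp: D_def)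
    then show ?thesis by (auto simp: last_coord_def m_def)
  next
    assume "\<forall>x\<in>D. u x < 0"
    then have pos: "- u x > 0" if "x $ m \<le> 0" for x using that by (simp add: D_def)
    have nonconst: "\<not> (\<lambda>x. - u x) constant_on UNIV"
    proof
      assume "(\<lambda>x. - u x) constant_on UNIV"
      then obtain c where "\<And>x. - u x = c" unfolding constant_on_def by blast
      then have "u x = - c" for x by (metis minus_minus)
      then show False using assms(3) unfolding constant_on_def by blast
    qed
    have cont': "continuous_on UNIV (\<lambda>x. - u x)" by (intro continuous_intros cont)
    have pde': "(\<Sum>i\<in>UNIV. - partial i (partial i u) x) = (- u x) ^ 3 - - u x" for x
      by (simp add: sum_negf pde)
    obtain a where a: "\<And>x. - u x = H (a - x $ m)"
      using solution_above_eq_profile[OF second_partials_minus[OF sp] cont' pde' card nonconst pos] by blast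
    have "u x = H (last_coord x + - a)" for x
      using a[of x] H_odd[of "a - x $ m"] by (simp add: last_coord_def m_def)
    then show ?thesis by blast
  qed
qed

end
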